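(* Suppose that for each $t\ge0$ the measure $\mu_t$ satisfies a logarithmic Sobolev inequality with constant $C_t^{LS}>0$, i.e. $$\int f^2\log\left(\frac{f}{\|f\|_{L^2(\mu_t)}}\right)^2d\mu_t\ \le\ C_t^{LS}\,\mathcal E_t(f)\qquad\text{for all } t\ge0 \text{ and } f:S\to\mathbb R .$$ Then, for $1<p\le q<\infty$, $$\|q_{s,t}f\|_{L^q(\mu_s)}\ \le\ \exp\left(\int_s^t\max_{x\in S}H_r^-(x)\,dr\right)\|f\|_{L^p(\mu_t)}$$ for all $f:S\to\mathbb R$ and all $0\le s\le t$ such that $$\int_s^t\frac{\lambda_r}{C_r^{LS}}\,dr\ \ge\ \frac14\log\frac{q-1}{p-1}.$$
   Context: **Setting.** $S$ is a finite set. For $t\ge0$, $\mu_t(x)=\frac1{Z_t}e^{-\mathcal H_t(x)}\mu_0(x)$ are probability measures on $S$ with $\mu_t(x)>0$ for all $x\in S$, where $Z_t$ is a normalization constant and $(t,x)\mapsto\mathcal H_t(x)$ is a function on $[0,\infty)\times S$ that is continuously differentiable in $t$. Put $$H_t(x):=-\frac{\partial}{\partial t}\log\mu_t(x)=\frac{\partial}{\partial t}\mathcal H_t(x)-\int\frac{\partial}{\partial t}\mathcal H_t\,d\mu_t ,\qquad H_t^-:=\max(-H_t,0).$$ For each $t\ge0$, $\mathcal L_t=(\mathcal L_t(x,y))_{x,y\in S}$ is a $Q$-matrix (off-diagonal entries $\ge0$, row sums $0$), continuous in $t$, satisfying detailed balance $\mu_t(x)\mathcal L_t(x,y)=\mu_t(y)\mathcal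 L_t(y,x)$ for all $x,y\in S$; $(\mathcal L_tf)(x)=\sum_y\mathcal L_t(x,y)f(y)$. A continuous function $t\mapsto\lambda_t\in(0,\infty)$ is fixed. The Dirichlet form is $\mathcal E_t(f)=-\int f\,\mathcal L_tf\,d\mu_t=\frac12\sum_{x,y}(f(y)-f(x))^2\mathcal L_t(x,y)\mu_t(x)$. For $0\le s\le t$ and $f:S\to\mathbb R$, $q_{s,t}f:S\to\mathbb R$ is the unique solution of the backward equation $$-\frac{\partial}{\partial s}q_{s,t}f=\lambda_s\mathcal L_sq_{s,t}f-H_s\,q_{s,t}f,\quad s\in[0,t],\qquad q_{t,t}f=f.$$ **Conventions.** $\|f\|_{L^p(\mu)}=\big(\sum_x|f(x)|^p\mu(x)\big)^{1/p}$; in the logarithmic Sobolev inequality the integrand is $0$ where $f=0$; $r\mapsto C_r^{LS}$ is measurable, so that the integral of $\lambda_r/C_r^{LS}$ makes sense. *)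

theory Defs
  imports "HOL-Probability.Probability"
begin

definition Lp_norm :: "'a::finite pmf \<Rightarrow> real \<Rightarrow> ('a \<Rightarrow> real) \<Rightarrow> real" where
  "Lp_norm m p f = (\<Sum>x\<in>UNIV. \<bar>f x\<bar> powr p * pmf m x) powr (1 / p)"

definition q_matrix :: "('a::finite \<Rightarrow> 'a \<Rightarrow> real) \<Rightarrow> bool" where
  "q_matrix Q \<longleftrightarrow> (\<forall>x y. x \<noteq> y \<longrightarrow> 0 \<le> Q x y) \<and> (\<forall>x. (\<Sum>y\<in>UNIV. Q x y) = 0)"

definition detailed_balance :: "'a::finite pmf \<Rightarrow> ('a \<Rightarrow> 'a \<Rightarrow> real) \<Rightarrow> bool" where
  "detailed_balance m Q \<longleftrightarrow> (\<forall>x y. pmf m x * Q x y = pmf m y * Q y x)"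

definition gen :: "('a::finite \<Rightarrow> 'a \<Rightarrow> real) \<Rightarrow> ('a \<Rightarrow> real) \<Rightarrow> 'a \<Rightarrow> real" where
  "gen Q f x = (\<Sum>y\<in>UNIV. Q x y * f y)"

definition dirichlet_form ::
    "'a::finite pmf \<Rightarrow> ('a \<Rightarrow> 'a \<Rightarrow> real) \<Rightarrow> ('a \<Rightarrow> real) \<Rightarrow> real" where
  "dirichlet_form m Q f = - measure_pmf.expectation m (\<lambda>x. f x * gen Q f x)"

text \<open>The integrand below is 0 wherever \<open>f\<close> vanishes, whatever the value of the logarithm there;
  for \<open>f = 0\<close> both sides are 0.\<close>

definition log_sobolev ::
    "'a::finite pmf \<Rightarrow> ('a \<Rightarrow> 'a \<Rightarrow> real) \<Rightarrow> real \<Rightarrow> bool" where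
  "log_sobolev m Q c \<longleftrightarrow>
     (\<forall>f. measure_pmf.expectation m (\<lambda>x. (f x)\<^sup>2 * ln ((f x / Lp_norm m 2 f)\<^sup>2))
            \<le> c * dirichlet_form m Q f)"

text \<open>Continuous differentiability on \<open>[0,\<infinity>)\<close>; the derivative at 0 is one-sided.\<close>

definition C1_on_nonneg :: "(real \<Rightarrow> real) \<Rightarrow> bool" where
  "C1_on_nonneg g \<longleftrightarrow>
     (\<exists>g'. (\<forall>t\<ge>0. (g has_real_derivative g' t) (at t within {0..})) \<and> continuous_on {0..} g')"

definition neg_dlog :: "(real \<Rightarrow> 'a::finite pmf) \<Rightarrow> real \<Rightarrow> 'a \<Rightarrow> real" where
  "neg_dlog \<mu> t x = - vector_derivative (\<lambda>r. ln (pmf (\<mu> r) x)) (at t within {0..})"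

text \<open>The equation \<open>- (d/ds) u\<^sub>s = \<lambda>\<^sub>s L\<^sub>s u\<^sub>s - H\<^sub>s u\<^sub>s\<close> on \<open>[0,t]\<close> with \<open>u\<^sub>t = f\<close>,
  with one-sided derivatives at the endpoints.\<close>

definition solves_backward ::
    "(real \<Rightarrow> real) \<Rightarrow> (real \<Rightarrow> 'a::finite \<Rightarrow> 'a \<Rightarrow> real) \<Rightarrow> (real \<Rightarrow> 'a \<Rightarrow> real) \<Rightarrow>
     real \<Rightarrow> ('a \<Rightarrow> real) \<Rightarrow> (real \<Rightarrow> 'a \<Rightarrow> real) \<Rightarrow> bool" where
  "solves_backward lam L H t f u \<longleftrightarrow>
     (\<forall>s\<in>{0..t}. \<forall>x. ((\<lambda>r. u r x) has_real_derivative
          - (lam s * gen (L s) (u s) x - H s x * u s x)) (at s within {0..t}))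
     \<and> u t = f"

text \<open>A solution is unique only as a function on \<open>[0,t]\<close> (its values elsewhere are arbitrary),
  so the definite description selects the value at \<open>s\<close> and not the whole solution.\<close>

definition backward_prop ::
    "(real \<Rightarrow> real) \<Rightarrow> (real \<Rightarrow> 'a::finite \<Rightarrow> 'a \<Rightarrow> real) \<Rightarrow> (real \<Rightarrow> 'a \<Rightarrow> real) \<Rightarrow>
     real \<Rightarrow> real \<Rightarrow> ('a \<Rightarrow> real) \<Rightarrow> 'a \<Rightarrow> real" where
  "backward_prop lam L H s t f = (THE v. \<exists>u. solves_backward lam L H t f u \<and> u s = v)"

end

theory Submission
  imports Defs
begin

text \<open>For \<open>f > 0\<close> the solution \<open>u\<^sub>r\<close> of the backward equation stays positive and
  \<open>\<Psi>(r, y) = ln \<parallel>u\<^sub>r\<parallel>\<close>, the norm taken in \<open>L\<^sup>q(\<mu>\<^sub>r)\<close> with \<open>q = 1 + e\<^bsup>4y\<^esup>\<close>, is smooth in both variables. The logarithmic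
  Sobolev inequality for \<open>u\<^bsup>q/2\<^esup>\<close> and the Stroock-Varopoulos inequality give the transport inequality
  \<open>(\<lambda>\<^sub>r / C\<^sub>r) \<partial>\<^sub>y\<Psi> \<le> \<partial>\<^sub>r\<Psi> + max H\<^sub>r\<^sup>-\<close>, so \<open>\<Psi>\<close> is controlled along the curve \<open>y' = - \<lambda>\<^sub>r / C\<^sub>r\<close>. Since
  \<open>\<lambda>\<^sub>r / C\<^sub>r\<close> is only measurable, the curve is not differentiable everywhere; monotonicity along it is
  obtained from estimates on short intervals rather than from a derivative, after decreasing the speed
  to an integrable function whose integral is exactly \<open>1/4 ln ((q - 1) / (p - 1))\<close>. A general \<open>f\<close> is
  dominated by \<open>\<bar>f\<bar> + \<epsilon>\<close>.\<close>

section \<open>Transport inequalities with integrable speed\<close>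

text \<open>If the chain rule applied along \<open>y' = - a\<close>, the derivative of
  \<open>\<Psi> r (y r)\<close> would be \<open>\<Psi>r - a * \<Psi>y\<close>, hence at least
  \<open>- M\<close>. For merely integrable \<open>a\<close> it is replaced by first-order
  expansions of \<open>\<Psi>\<close> about single points. Their error is a small multiple of
  elapsed time plus the drop of \<open>y\<close>, and this quantity adds up over adjacent
  intervals.\<close>

lemma transport_monotone:
  fixes \<Psi> \<Psi>r \<Psi>y :: "real \<Rightarrow> real \<Rightarrow> real" and a M :: "real \<Rightarrow> real"
  assumes "s \<le> t"
    and D: "\<And>r y. r \<in> {s..t} \<Longrightarrow> ((\<lambda>z. \<Psi> (fst z) (snd z)) has_derivative
              (\<lambda>h. \<Psi>r r y * fst h + \<Psi>y r y * snd h)) (at (r, y) within {s..t} \<times> UNIV)"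
    and cr: "\<And>y. continuous_on {s..t} (\<lambda>r. \<Psi>r r y)"
    and cy: "\<And>y. continuous_on {s..t} (\<lambda>r. \<Psi>y r y)"
    and a: "a integrable_on {s..t}" "\<And>r. r \<in> {s..t} \<Longrightarrow> 0 \<le> a r"
    and M: "M integrable_on {s..t}"
    and ineq: "\<And>r y. r \<in> {s..t} \<Longrightarrow> a r * \<Psi>y r y \<le> \<Psi>r r y + M r"
  shows "\<Psi> s (y\<^sub>0 + integral {s..t} a) \<le> \<Psi> t y\<^sub>0 + integral {s..t} M"
proof -
  \<comment> \<open>The curve of speed \<open>- a\<close> that is at \<open>y\<^sub>0\<close> at
    time \<open>t\<close>. Subtracting the remaining integral of \<open>M\<close> turns the claim
    into \<open>G s \<le> G t\<close>.\<close>
  define y where "y r = y\<^sub>0 + integral {r..t} a" for r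
  define G where "G r = \<Psi> r (y r) - integral {r..t} M" for r
  have ycont: "continuous_on {s..t} y"
    unfolding y_def by (intro continuous_intros indefinite_integral_continuous_1' a)
  have split: "integral {r..t} h - integral {r'..t} h = integral {r..r'} h" "h integrable_on {r..r'}"
    if "h integrable_on {s..t}" "s \<le> r" "r \<le> r'" "r' \<le> t" for h :: "real \<Rightarrow> real" and r r'
  proof -
    have h: "h integrable_on {r..t}" "h integrable_on {r..r'}"
      using that by (auto intro: integrable_on_subinterval)
    then show "integral {r..t} h - integral {r'..t} h = integral {r..r'} h" "h integrable_on {r..r'}"
      using Henstock_Kurzweil_Integration.integral_combine[OF _ _ h(1), of r'] that by auto
  qed
  have y_diff: "y r - y r' = integral {r..r'} a" "0 \<le> y r - y r'"
    if "s \<le> r" "r \<le> r'" "r' \<le> t" for r r'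
  proof -
    show 1: "y r - y r' = integral {r..r'} a"
      using split(1)[OF a(1) that] by (simp add: y_def)
    show "0 \<le> y r - y r'"
      unfolding 1 using that a by (intro integral_nonneg split(2)[OF a(1)]) auto
  qed
  have main: "G s \<le> G t + \<epsilon> * ((t - s) + (y s - y t))" if "\<epsilon> > 0" for \<epsilon>
  proof -
    \<comment> \<open>One half of \<open>\<epsilon>\<close> pays for the expansion of
      \<open>\<Psi>\<close>, the other half for freezing its partial derivatives at
      \<open>x\<close>.\<close>
    define e where "e = \<epsilon> / 2"
    have e: "e > 0" using that by (simp add: e_def)
    \<comment> \<open>The error term is additive, so \<open>P\<close> is transitive and bisection
      leaves only short intervals around a point \<open>x\<close>. Such intervals may stick out of
      \<open>{s..t}\<close>, hence the guard.\<close>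
    define P where "P u v \<longleftrightarrow> (s \<le> u \<and> v \<le> t \<longrightarrow> G u \<le> G v + \<epsilon> * ((v - u) + (y u - y v)))" for u v
    have "P s t"
      using \<open>s \<le> t\<close>
    proof (induction rule: Bolzano)
      case (trans u v w)
      then show ?case by (auto simp: P_def algebra_simps)
    next
      case (local x)
      then have x: "x \<in> {s..t}" by auto
      obtain d1 where d1: "d1 > 0" and d1': "\<And>z. z \<in> {s..t} \<times> UNIV \<Longrightarrow> norm (z - (x, y x)) < d1 \<Longrightarrow>
          norm (\<Psi> (fst z) (snd z) - \<Psi> x (y x)
             - (\<Psi>r x (y x) * fst (z - (x, y x)) + \<Psi>y x (y x) * snd (z - (x, y x))))
          \<le> e * norm (z - (x, y x))"
        using D[OF x, of "y x"] e unfolding has_derivative_within_alt by fastforce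
      obtain d2 where d2: "d2 > 0" "\<And>r. r \<in> {s..t} \<Longrightarrow> \<bar>r - x\<bar> < d2 \<Longrightarrow> \<bar>y r - y x\<bar> < d1 / 2"
        using ycont[unfolded continuous_on_iff, rule_format, OF x, of "d1/2"] d1
        by (auto simp: dist_real_def)
      obtain d3 where d3: "d3 > 0" "\<And>r. r \<in> {s..t} \<Longrightarrow> \<bar>r - x\<bar> < d3 \<Longrightarrow> \<bar>\<Psi>r r (y x) - \<Psi>r x (y x)\<bar> < e"
        using cr[of "y x", unfolded continuous_on_iff, rule_format, OF x, of e] e
        by (auto simp: dist_real_def)
      obtain d4 where d4: "d4 > 0" "\<And>r. r \<in> {s..t} \<Longrightarrow> \<bar>r - x\<bar> < d4 \<Longrightarrow> \<bar>\<Psi>y r (y x) - \<Psi>y x (y x)\<bar> < e"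
        using cy[of "y x", unfolded continuous_on_iff, rule_format, OF x, of e] e
        by (auto simp: dist_real_def)
      \<comment> \<open>With \<open>d1/2\<close> for the time increment and \<open>d2\<close> for
        the increment of \<open>y\<close>, the point \<open>(r, y r)\<close> stays in the ball of
        radius \<open>d1\<close> around \<open>(x, y x)\<close>.\<close>
      define d where "d = Min {d1/2, d2, d3, d4}"
      have d: "d > 0" "d \<le> d1/2" "d \<le> d2" "d \<le> d3" "d \<le> d4"
        using d1 d2 d3 d4 by (auto simp: d_def)
      have near: "\<bar>\<Psi> r (y r) - \<Psi> x (y x) - (\<Psi>r x (y x) * (r - x) + \<Psi>y x (y x) * (y r - y x))\<bar>
          \<le> e * (\<bar>r - x\<bar> + \<bar>y r - y x\<bar>)" if "r \<in> {s..t}" "\<bar>r - x\<bar> < d" for r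
      proof -
        have n: "norm ((r, y r) - (x, y x)) \<le> \<bar>r - x\<bar> + \<bar>y r - y x\<bar>"
          using norm_Pair_le[of "r - x" "y r - y x"] by simp
        also have "\<dots> < d1"
          using that d d2(2)[of r] by simp
        finally have "norm (\<Psi> r (y r) - \<Psi> x (y x)
            - (\<Psi>r x (y x) * (r - x) + \<Psi>y x (y x) * (y r - y x))) \<le> e * norm ((r, y r) - (x, y x))"
          using d1'[of "(r, y r)"] that(1) by simp
        also have "\<dots> \<le> e * (\<bar>r - x\<bar> + \<bar>y r - y x\<bar>)"
          using n e by (intro mult_left_mono) auto
        finally show ?thesis by simp
      qed
      show ?case
      proof (intro exI[of _ d] conjI d(1) allI impI; elim conjE)
        fix r r' assume rx: "r \<le> x" "x \<le> r'" "r' - r < d"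
        have "G r \<le> G r' + \<epsilon> * ((r' - r) + (y r - y r'))" if st: "s \<le> r" "r' \<le> t"
        proof -
          note r = rx st
          define A where "A = integral {r..r'} a"
          have A: "y r - y r' = A"
            using y_diff[of r r'] r by (auto simp: A_def)
          \<comment> \<open>The differential inequality is integrated with its second argument
            frozen at \<open>y x\<close>; on this interval both partial derivatives differ from
            their values at \<open>x\<close> by less than \<open>e\<close>.\<close>
          have "integral {r..r'} (\<lambda>\<tau>. a \<tau> * (\<Psi>y x (y x) - e)) \<le> integral {r..r'} (\<lambda>\<tau>. (\<Psi>r x (y x) + e) + M \<tau>)"
          proof (rule integral_le)
            show "(\<lambda>\<tau>. a \<tau> * (\<Psi>y x (y x) - e)) integrable_on {r..r'}"
              using split(2)[OF a(1)] r by (intro integrable_on_mult_left) auto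
            show "(\<lambda>\<tau>. (\<Psi>r x (y x) + e) + M \<tau>) integrable_on {r..r'}"
              using split(2)[OF M] r by (intro integrable_add integrable_const_ivl) auto
            fix \<tau> assume "\<tau> \<in> {r..r'}"
            then have \<tau>: "\<tau> \<in> {s..t}" "\<bar>\<tau> - x\<bar> < d" using r by auto
            have "a \<tau> * (\<Psi>y x (y x) - e) \<le> a \<tau> * \<Psi>y \<tau> (y x)"
              using d4(2)[of \<tau>] \<tau> d a(2) by (intro mult_left_mono) auto
            also have "\<dots> \<le> \<Psi>r \<tau> (y x) + M \<tau>" by (rule ineq[OF \<tau>(1)])
            also have "\<dots> \<le> (\<Psi>r x (y x) + e) + M \<tau>" using d3(2)[of \<tau>] \<tau> d by auto
            finally show "a \<tau> * (\<Psi>y x (y x) - e) \<le> (\<Psi>r x (y x) + e) + M \<tau>" .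
          qed
          moreover have "integral {r..r'} (\<lambda>\<tau>. (\<Psi>r x (y x) + e) + M \<tau>)
              = (\<Psi>r x (y x) + e) * (r' - r) + integral {r..r'} M"
            using split(2)[OF M] r by (subst integral_add) (auto simp: integrable_const_ivl)
          ultimately have I: "A * (\<Psi>y x (y x) - e) \<le> (\<Psi>r x (y x) + e) * (r' - r) + integral {r..r'} M"
            by (simp add: A_def)
          have "\<bar>\<Psi> r (y r) - \<Psi> x (y x) - (\<Psi>r x (y x) * (r - x) + \<Psi>y x (y x) * (y r - y x))\<bar>
              \<le> e * ((x - r) + (y r - y x))"
            using near[of r] r y_diff[of r x] by auto
          moreover have "\<bar>\<Psi> r' (y r') - \<Psi> x (y x) - (\<Psi>r x (y x) * (r' - x) + \<Psi>y x (y x) * (y r' - y x))\<bar>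
              \<le> e * ((r' - x) + (y x - y r'))"
            using near[of r'] r y_diff[of x r'] by auto
          \<comment> \<open>Because \<open>y\<close> is nonincreasing and \<open>x\<close> lies
            between \<open>r\<close> and \<open>r'\<close>, the errors of the two expansions sum to
            exactly \<open>e * ((r' - r) + A)\<close>.\<close>
          ultimately have "\<Psi> r (y r) - \<Psi> r' (y r') \<le> \<Psi>r x (y x) * (r - r') + \<Psi>y x (y x) * A
              + e * ((r' - r) + A)"
            unfolding A[symmetric] by (simp add: algebra_simps abs_le_iff)
          with I have "\<Psi> r (y r) - \<Psi> r' (y r') \<le> integral {r..r'} M + 2 * e * ((r' - r) + A)"
            by (simp add: algebra_simps)
          moreover have "integral {r..t} M - integral {r'..t} M = integral {r..r'} M"
            using split(1)[OF M] r by auto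
          ultimately show ?thesis
            unfolding A G_def by (simp add: e_def)
        qed
        then show "P r r'" by (simp add: P_def)
      qed
    qed
    then show ?thesis by (simp add: P_def)
  qed
  have "G s \<le> G t"
  proof (rule field_le_epsilon)
    fix \<epsilon> :: real assume \<epsilon>: "\<epsilon> > 0"
    \<comment> \<open>The total error weight on \<open>{s..t}\<close>; dividing by
      \<open>c + 1\<close> instead of \<open>c\<close> allows for \<open>c = 0\<close>.\<close>
    define c where "c = (t - s) + (y s - y t)"
    have c: "c \<ge> 0" using y_diff[of s t] \<open>s \<le> t\<close> by (simp add: c_def)
    have "G s \<le> G t + \<epsilon> / (c + 1) * c"
      using main[of "\<epsilon> / (c + 1)"] \<epsilon> c by (simp add: c_def)
    also have "\<epsilon> / (c + 1) * c \<le> \<epsilon>" using \<epsilon> c by (simp add: field_simps)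
    finally show "G s \<le> G t + \<epsilon>" by simp
  qed
  then show ?thesis by (simp add: G_def y_def)
qed

section \<open>The backward equation\<close>

text \<open>The \<open>n\<close>-th term of the time-ordered exponential series, not its partial
  sum: \<open>n\<close> nested integrals of products of the matrices \<open>B\<close>, applied to
  \<open>f\<close>.\<close>

fun picard :: "(real \<Rightarrow> 'a::finite \<Rightarrow> 'a \<Rightarrow> real) \<Rightarrow> real \<Rightarrow> ('a \<Rightarrow> real) \<Rightarrow> nat \<Rightarrow> real \<Rightarrow> 'a \<Rightarrow> real" where
  "picard B T f 0 s x = f x"
| "picard B T f (Suc n) s x = integral {s..T} (\<lambda>r. gen (B r) (picard B T f n r) x)"

lemma continuous_on_gen:
  assumes "\<And>x y. continuous_on S (\<lambda>r. B r x y)" "\<And>y. continuous_on S (\<lambda>r. v r y)"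
  shows "continuous_on S (\<lambda>r. gen (B r) (v r) x)"
  unfolding gen_def by (intro continuous_intros assms)

lemma continuous_on_Icc_upper_bound:
  fixes g :: "real \<Rightarrow> real"
  assumes "continuous_on {a..b} g"
  obtains K where "K > 0" "\<And>r. r \<in> {a..b} \<Longrightarrow> g r \<le> K"
proof -
  have "bounded (g ` {a..b})"
    using assms by (intro compact_imp_bounded compact_continuous_image) auto
  then obtain K where "K > 0" "\<forall>z\<in>g ` {a..b}. norm z \<le> K"
    unfolding bounded_pos by blast
  then show thesis by (intro that[of K]) (auto intro: order_trans[OF abs_ge_self])
qed

text \<open>The solution is the sum of the series \<open>picard\<close>. Since \<open>B\<close> has
  no negative entries, all terms are nonnegative when \<open>f\<close> is, so the sum dominates its
  zeroth term \<open>f\<close>; strict positivity of solutions comes from this bound.\<close>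

lemma nonneg_linear_backward_exists:
  fixes B :: "real \<Rightarrow> 'a::finite \<Rightarrow> 'a \<Rightarrow> real"
  assumes "0 \<le> T" and cont: "\<And>x y. continuous_on {0..T} (\<lambda>r. B r x y)"
    and nonneg: "\<And>r x y. r \<in> {0..T} \<Longrightarrow> 0 \<le> B r x y"
  shows "\<exists>u. (\<forall>s\<in>{0..T}. \<forall>x. ((\<lambda>r. u r x) has_real_derivative - gen (B s) (u s) x) (at s within {0..T}))
    \<and> u T = f \<and> ((\<forall>x. 0 \<le> f x) \<longrightarrow> (\<forall>s\<in>{0..T}. \<forall>x. f x \<le> u s x))"
proof -
  define w where "w = picard B T f"
  have wc: "continuous_on {0..T} (\<lambda>s. w n s x)" for n x
  proof (induction n arbitrary: x)
    case (Suc n)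
    show ?case unfolding w_def picard.simps
      by (intro indefinite_integral_continuous_1' integrable_continuous_real
          continuous_on_gen cont Suc[unfolded w_def])
  qed (simp add: w_def)
  have gc: "continuous_on {0..T} (\<lambda>r. gen (B r) (w n r) x)" for n x
    by (intro continuous_on_gen cont wc)
  have wd: "((\<lambda>r. w (Suc n) r x) has_real_derivative - gen (B s) (w n s) x) (at s within {0..T})"
    if "s \<in> {0..T}" for n s x
    using integral_has_real_derivative'[OF gc that] by (simp add: w_def)
  have "continuous_on {0..T} (\<lambda>r. \<Sum>x\<in>UNIV. \<Sum>y\<in>UNIV. B r x y)"
    by (intro continuous_intros cont)
  then obtain K where K: "K > 0" "\<And>r. r \<in> {0..T} \<Longrightarrow> (\<Sum>x\<in>UNIV. \<Sum>y\<in>UNIV. B r x y) \<le> K"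
    by (rule continuous_on_Icc_upper_bound) blast
  have row: "(\<Sum>y\<in>UNIV. B r x y) \<le> K" if "r \<in> {0..T}" for r x
  proof -
    have "(\<Sum>y\<in>UNIV. B r x y) \<le> (\<Sum>x\<in>UNIV. \<Sum>y\<in>UNIV. B r x y)"
      using nonneg[OF that] by (intro member_le_sum sum_nonneg) auto
    then show ?thesis using K(2)[OF that] by linarith
  qed
  define m where "m = (\<Sum>x\<in>UNIV. \<bar>f x\<bar>)"
  have m: "\<bar>f x\<bar> \<le> m" "0 \<le> m" for x
    unfolding m_def by (auto intro: member_le_sum sum_nonneg)
  have gen_bound: "\<bar>gen (B r) v x\<bar> \<le> K * b"
    if "r \<in> {0..T}" "\<And>y. \<bar>v y\<bar> \<le> b" for r x b and v :: "'a \<Rightarrow> real"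
  proof -
    have b: "b \<ge> 0" using that(2)[of undefined] by linarith
    have "\<bar>gen (B r) v x\<bar> \<le> (\<Sum>y\<in>UNIV. \<bar>B r x y * v y\<bar>)"
      unfolding gen_def by (rule sum_abs)
    also have "\<dots> \<le> (\<Sum>y\<in>UNIV. B r x y * b)"
      using nonneg[OF that(1)] that(2) by (intro sum_mono) (auto simp: abs_mult intro: mult_left_mono)
    also have "\<dots> = (\<Sum>y\<in>UNIV. B r x y) * b" by (simp add: sum_distrib_right)
    also have "\<dots> \<le> K * b" using row[OF that(1)] b by (intro mult_right_mono) auto
    finally show ?thesis .
  qed
  \<comment> \<open>With the weight \<open>exp (2 * K * (T - s))\<close>, integrating against
    \<open>K\<close> gains a factor \<open>1/2\<close>, so the series is dominated by a geometric
    one.\<close>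
  have wb: "\<bar>w n s x\<bar> \<le> m * (1/2)^n * exp (2 * K * (T - s))" if "s \<in> {0..T}" for n s x
    using that
  proof (induction n arbitrary: s x)
    case 0
    have "m * 1 \<le> m * exp (2 * K * (T - s))"
      using 0 K m by (intro mult_left_mono) auto
    then show ?case using m(1)[of x] by (simp add: w_def)
  next
    case (Suc n)
    let ?c = "m * (1/2)^n"
    let ?g = "\<lambda>r. K * (?c * exp (2 * K * (T - r)))"
    let ?F = "\<lambda>r. - (?c / 2) * exp (2 * K * (T - r))"
    have hi: "(?g has_integral ?F T - ?F s) {s..T}"
      using Suc.prems K(1)
      by (intro fundamental_theorem_of_calculus)
         (auto intro!: derivative_eq_intros simp flip: has_real_derivative_iff_has_vector_derivative)
    have "\<bar>w (Suc n) s x\<bar> \<le> integral {s..T} ?g"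
      unfolding w_def picard.simps real_norm_def[symmetric]
    proof (rule integral_norm_bound_integral)
      show "(\<lambda>r. gen (B r) (picard B T f n r) x) integrable_on {s..T}"
        using gc[of n x] Suc.prems unfolding w_def
        by (intro integrable_continuous_real) (auto elim: continuous_on_subset)
      show "?g integrable_on {s..T}" using hi by blast
      fix r assume "r \<in> {s..T}"
      then have r: "r \<in> {0..T}" using Suc.prems by auto
      show "norm (gen (B r) (picard B T f n r) x) \<le> ?g r"
        using gen_bound[OF r, of "w n r" "?c * exp (2 * K * (T - r))" x] Suc.IH[OF r] by (simp add: w_def)
    qed
    also have "\<dots> = ?F T - ?F s" using hi by (rule integral_unique)
    also have "\<dots> \<le> m * (1/2)^Suc n * exp (2 * K * (T - s))" using m(2) by simp
    finally show ?case .
  qed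
  define E where "E = exp (2 * K * T)"
  have wb': "\<bar>w n s x\<bar> \<le> m * E * (1/2)^n" if "s \<in> {0..T}" for n s x
  proof -
    have "m * (1/2)^n * exp (2 * K * (T - s)) \<le> m * (1/2)^n * E"
      using that K m unfolding E_def by (intro mult_left_mono) auto
    then show ?thesis using wb[OF that, of n x] by (simp add: mult_ac)
  qed
  have geo: "summable (\<lambda>n. c * (1/2::real)^n)" for c
    by (intro summable_mult summable_geometric) simp
  have sw: "summable (\<lambda>n. w n s x)" if "s \<in> {0..T}" for s x
    by (rule summable_comparison_test'[OF geo[of "m * E"]]) (use wb'[OF that] in auto)
  define u where "u s x = (\<Sum>n. w n s x)" for s x
  have der: "((\<lambda>r. u r x) has_real_derivative - gen (B s) (u s) x) (at s within {0..T})"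
    if s: "s \<in> {0..T}" for s x
  proof -
    have ul: "uniform_limit {0..T} (\<lambda>n s. \<Sum>i<n. - gen (B s) (w i s) x)
        (\<lambda>s. \<Sum>i. - gen (B s) (w i s) x) sequentially"
    proof (rule Weierstrass_m_test)
      show "summable (\<lambda>n. K * m * E * (1/2)^n)" by (rule geo)
      show "norm (- gen (B s) (w n s) x) \<le> K * m * E * (1/2)^n" if "s \<in> {0..T}" for n s
        using gen_bound[OF that wb'[OF that]] by (simp add: mult_ac)
    qed
    have gs: "(\<Sum>i. - gen (B s) (w i s) x) = - gen (B s) (u s) x" if "s \<in> {0..T}" for s
      unfolding gen_def u_def
      by (subst suminf_minus, intro summable_sum summable_mult sw[OF that],
          subst suminf_sum, intro summable_mult sw[OF that],
          subst suminf_mult, intro sw[OF that], simp)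
    \<comment> \<open>Termwise differentiation: the derivative of term \<open>n + 1\<close> is
      \<open>- gen\<close> of term \<open>n\<close>. The series therefore starts at index 1, and the
      constant term \<open>f\<close> is added back afterwards.\<close>
    have "\<exists>g. \<forall>s\<in>{0..T}. (\<lambda>n. w (Suc n) s x) sums g s \<and>
        (g has_real_derivative (\<Sum>i. - gen (B s) (w i s) x)) (at s within {0..T})"
    proof (rule has_field_derivative_series[OF _ wd ul s])
      show "summable (\<lambda>n. w (Suc n) s x)" using sw[OF s, of x] by (subst summable_Suc_iff)
    qed auto
    then obtain g where g: "\<And>s. s \<in> {0..T} \<Longrightarrow> (\<lambda>n. w (Suc n) s x) sums g s"
      "\<And>s. s \<in> {0..T} \<Longrightarrow> (g has_real_derivative (\<Sum>i. - gen (B s) (w i s) x)) (at s within {0..T})"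
      by blast
    have ug: "u r x = f x + g r" if "r \<in> {0..T}" for r
      using suminf_split_head[OF sw[OF that, of x]] g(1)[OF that] by (simp add: u_def w_def sums_iff)
    have "((\<lambda>r. f x + g r) has_real_derivative - gen (B s) (u s) x) (at s within {0..T})"
      using g(2)[OF s] gs[OF s] by (auto intro!: derivative_eq_intros)
    then show ?thesis
      by (rule has_field_derivative_transform_within[where d = 1]) (use s in \<open>auto simp: ug\<close>)
  qed
  have uT: "u T = f"
  proof
    fix x
    have "w n T x = (if n = 0 then f x else 0)" for n
      by (cases n) (auto simp: w_def)
    then show "u T x = f x"
      unfolding u_def by (subst suminf_finite[of "{0}"]) auto
  qed
  have pos: "f x \<le> u s x" if f: "\<And>x. 0 \<le> f x" and s: "s \<in> {0..T}" for s x
  proof -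
    have wn: "0 \<le> w n s x" if "s \<in> {0..T}" for n s x
      using that
    proof (induction n arbitrary: s x)
      case (Suc n)
      have "continuous_on {s..T} (\<lambda>r. gen (B r) (w n r) x)"
        using gc[of n x] Suc.prems by (auto elim: continuous_on_subset)
      then show ?case unfolding w_def picard.simps unfolding w_def[symmetric]
        using Suc nonneg
        by (intro integral_nonneg integrable_continuous_real) (auto simp: gen_def intro!: sum_nonneg)
    qed (simp add: w_def f)
    have "sum (\<lambda>n. w n s x) {0} \<le> u s x"
      unfolding u_def using wn[OF s] by (intro sum_le_suminf sw s) auto
    then show ?thesis by (simp add: w_def)
  qed
  show ?thesis using der uT pos by blast
qed

lemma solves_backward_alt:
  "solves_backward lam L H t f u \<longleftrightarrow>
     (\<forall>s\<in>{0..t}. \<forall>x. ((\<lambda>r. u r x) has_real_derivative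
        - gen (\<lambda>x y. lam s * L s x y - (if x = y then H s x else 0)) (u s) x) (at s within {0..t}))
     \<and> u t = f"
proof -
  have "gen (\<lambda>x y. lam s * L s x y - (if x = y then H s x else 0)) v x
      = lam s * gen (L s) v x - H s x * v x" for s v x
    by (simp add: gen_def algebra_simps sum_subtractf sum_distrib_left if_distrib[of "\<lambda>c. _ * c"]
        sum.delta cong: if_cong)
  then show ?thesis unfolding solves_backward_def by simp
qed

text \<open>Adding a constant \<open>c\<close> to the diagonal makes the coefficient matrix entrywise nonnegative, so that
  every term of the Picard series is; the factor \<open>e\<^bsup>c(r-T)\<^esup>\<close> undoes the shift.\<close>

lemma solves_backward_exists:
  fixes L :: "real \<Rightarrow> 'a::finite \<Rightarrow> 'a \<Rightarrow> real"
  assumes "0 \<le> T" and L: "\<And>x y. continuous_on {0..T} (\<lambda>r. L r x y)"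
    and lam: "continuous_on {0..T} lam" and H: "\<And>x. continuous_on {0..T} (\<lambda>r. H r x)"
    and lam_nonneg: "\<And>r. r \<in> {0..T} \<Longrightarrow> 0 \<le> lam r" and Q: "\<And>r. r \<in> {0..T} \<Longrightarrow> q_matrix (L r)"
  shows "\<exists>u. solves_backward lam L H T f u \<and>
    ((\<forall>x. 0 \<le> f x) \<longrightarrow> (\<forall>s\<in>{0..T}. \<forall>x. 0 \<le> u s x)) \<and>
    ((\<forall>x. 0 < f x) \<longrightarrow> (\<forall>s\<in>{0..T}. \<forall>x. 0 < u s x))"
proof -
  define A where "A r x y = lam r * L r x y - (if x = y then H r x else 0)" for r x y
  have A: "continuous_on {0..T} (\<lambda>r. A r x y)" for x y
    unfolding A_def by (cases "x = y") (auto intro!: continuous_intros L lam H)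
  have "continuous_on {0..T} (\<lambda>r. \<Sum>x\<in>UNIV. \<bar>A r x x\<bar>)"
    by (intro continuous_intros A)
  then obtain c where c: "\<And>r. r \<in> {0..T} \<Longrightarrow> (\<Sum>x\<in>UNIV. \<bar>A r x x\<bar>) \<le> c"
    by (rule continuous_on_Icc_upper_bound) blast
  have diag: "\<bar>A r x x\<bar> \<le> c" if "r \<in> {0..T}" for r x
  proof -
    have "\<bar>A r x x\<bar> \<le> (\<Sum>x\<in>UNIV. \<bar>A r x x\<bar>)" by (intro member_le_sum) auto
    with c[OF that] show ?thesis by linarith
  qed
  define B where "B r x y = A r x y + (if x = y then c else 0)" for r x y
  have "continuous_on {0..T} (\<lambda>r. B r x y)" for x y
    unfolding B_def by (cases "x = y") (auto intro!: continuous_intros A)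
  moreover have "0 \<le> B r x y" if "r \<in> {0..T}" for r x y
    using diag[OF that, of x] lam_nonneg[OF that] Q[OF that]
    by (auto simp: B_def A_def q_matrix_def abs_le_iff)
  ultimately obtain w where w:
    "\<And>s x. s \<in> {0..T} \<Longrightarrow> ((\<lambda>r. w r x) has_real_derivative - gen (B s) (w s) x) (at s within {0..T})"
    "w T = f" "(\<forall>x. 0 \<le> f x) \<longrightarrow> (\<forall>s\<in>{0..T}. \<forall>x. f x \<le> w s x)"
    using nonneg_linear_backward_exists[OF \<open>0 \<le> T\<close>, of B f] by blast
  have gB: "gen (B s) v x = gen (A s) v x + c * v x" for s v x
    by (simp add: gen_def B_def algebra_simps sum.distrib if_distrib[of "\<lambda>c. _ * c"] sum.delta cong: if_cong)
  define u where "u r x = exp (c * (r - T)) * w r x" for r x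
  have "((\<lambda>r. u r x) has_real_derivative - gen (A s) (u s) x) (at s within {0..T})"
    if "s \<in> {0..T}" for s x
  proof -
    have "gen (A s) (u s) x = exp (c * (s - T)) * gen (A s) (w s) x"
      by (simp add: gen_def u_def sum_distrib_left mult_ac)
    then show ?thesis unfolding u_def
      by (auto intro!: derivative_eq_intros w(1)[OF that] simp: gB algebra_simps)
  qed
  then have "solves_backward lam L H T f u"
    unfolding solves_backward_alt A_def using w(2) by (auto simp: u_def)
  moreover have "(\<forall>x. 0 \<le> f x) \<longrightarrow> (\<forall>s\<in>{0..T}. \<forall>x. 0 \<le> u s x)"
    using w(3) unfolding u_def by (meson exp_ge_zero mult_nonneg_nonneg order_trans)
  moreover have "(\<forall>x. 0 < f x) \<longrightarrow> (\<forall>s\<in>{0..T}. \<forall>x. 0 < u s x)"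
    using w(3) unfolding u_def by (meson exp_gt_zero mult_pos_pos less_imp_le less_le_trans)
  ultimately show ?thesis by blast
qed

section \<open>Linearity and uniqueness for the backward equation\<close>

lemma solves_backward_lincomb:
  assumes "solves_backward lam L H t f u" "solves_backward lam L H t g v"
  shows "solves_backward lam L H t (\<lambda>x. a * f x + b * g x) (\<lambda>r x. a * u r x + b * v r x)"
proof -
  have "gen Q (\<lambda>x. a * u s x + b * v s x) x = a * gen Q (u s) x + b * gen Q (v s) x" for Q s x
    by (simp add: gen_def algebra_simps sum.distrib sum_distrib_left)
  then show ?thesis using assms unfolding solves_backward_alt
    by (auto intro!: derivative_eq_intros)
qed

text \<open>A Gronwall argument run backwards: the squared Euclidean norm of \<open>d\<close> times
  \<open>exp (2 * K * r)\<close> is nondecreasing in \<open>r\<close> once \<open>K\<close> bounds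
  the sum of all absolute matrix entries. It is nonnegative and vanishes at \<open>T\<close>, so it
  vanishes throughout.\<close>

lemma solves_backward_zero_unique:
  fixes L :: "real \<Rightarrow> 'a::finite \<Rightarrow> 'a \<Rightarrow> real"
  assumes L: "\<And>x y. continuous_on {0..T} (\<lambda>r. L r x y)"
    and lam: "continuous_on {0..T} lam" and H: "\<And>x. continuous_on {0..T} (\<lambda>r. H r x)"
    and u: "solves_backward lam L H T (\<lambda>_. 0) d" and s: "s \<in> {0..T}"
  shows "d s x = 0"
proof -
  define A where "A r x y = lam r * L r x y - (if x = y then H r x else 0)" for r x y
  have A: "continuous_on {0..T} (\<lambda>r. A r x y)" for x y
    unfolding A_def by (cases "x = y") (auto intro!: continuous_intros L lam H)
  have "continuous_on {0..T} (\<lambda>r. \<Sum>x\<in>UNIV. \<Sum>y\<in>UNIV. \<bar>A r x y\<bar>)"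
    by (intro continuous_intros A)
  then obtain K where K: "\<And>r. r \<in> {0..T} \<Longrightarrow> (\<Sum>x\<in>UNIV. \<Sum>y\<in>UNIV. \<bar>A r x y\<bar>) \<le> K"
    by (rule continuous_on_Icc_upper_bound) blast
  have dd: "((\<lambda>r. d r x) has_real_derivative - gen (A r) (d r) x) (at r within {0..T})"
    if "r \<in> {0..T}" for r x
    using u that unfolding solves_backward_alt A_def by blast
  define \<phi> where "\<phi> r = (\<Sum>x\<in>UNIV. (d r x)\<^sup>2)" for r
  have \<phi>0: "\<phi> r \<ge> 0" for r unfolding \<phi>_def by (intro sum_nonneg) auto
  have quad: "(\<Sum>x\<in>UNIV. d r x * gen (A r) (d r) x) \<le> K * \<phi> r" if "r \<in> {0..T}" for r
  proof -
    have sq: "(d r x)\<^sup>2 \<le> \<phi> r" for x unfolding \<phi>_def by (intro member_le_sum) auto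
    have "A r x y * (d r x * d r y) \<le> \<bar>A r x y\<bar> * \<phi> r" for x y
    proof -
      have "\<bar>d r x\<bar> * \<bar>d r y\<bar> \<le> \<phi> r"
        using sum_squares_bound[of "\<bar>d r x\<bar>" "\<bar>d r y\<bar>"] sq[of x] sq[of y] by simp
      then have "\<bar>A r x y\<bar> * (\<bar>d r x\<bar> * \<bar>d r y\<bar>) \<le> \<bar>A r x y\<bar> * \<phi> r" by (intro mult_left_mono) auto
      then show ?thesis by (metis abs_ge_self abs_mult order_trans)
    qed
    then have "(\<Sum>x\<in>UNIV. \<Sum>y\<in>UNIV. A r x y * (d r x * d r y)) \<le> (\<Sum>x\<in>UNIV. \<Sum>y\<in>UNIV. \<bar>A r x y\<bar> * \<phi> r)"
      by (intro sum_mono) auto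
    also have "\<dots> = (\<Sum>x\<in>UNIV. \<Sum>y\<in>UNIV. \<bar>A r x y\<bar>) * \<phi> r" by (simp add: sum_distrib_right)
    also have "\<dots> \<le> K * \<phi> r" using K[OF that] \<phi>0 by (intro mult_right_mono) auto
    finally show ?thesis by (simp add: gen_def sum_distrib_left mult_ac)
  qed
  define g where "g r = exp (2 * K * r) * \<phi> r" for r
  have dg: "(g has_real_derivative 2 * exp (2 * K * r) * (K * \<phi> r - (\<Sum>x\<in>UNIV. d r x * gen (A r) (d r) x)))
      (at r within {0..T})" if "r \<in> {0..T}" for r
  proof -
    have "(\<phi> has_real_derivative - 2 * (\<Sum>x\<in>UNIV. d r x * gen (A r) (d r) x)) (at r within {0..T})"
      unfolding \<phi>_def
      by (auto intro!: derivative_eq_intros dd[OF that] simp: sum_negf sum_distrib_left mult_ac)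
    then show ?thesis unfolding g_def
      by (auto intro!: derivative_eq_intros simp: algebra_simps)
  qed
  have "g s \<le> g T"
  proof (rule DERIV_nonneg_imp_increasing_open[where f = g])
    show "s \<le> T" using s by auto
  next
    fix r assume that: "s < r" "r < T"
    show "\<exists>y. DERIV g r :> y \<and> 0 \<le> y"
    proof -
      have "r \<in> {0..T}" "at r within {0..T} = at r" using that s by (auto simp: at_within_Icc_at)
      then show ?thesis using dg[of r] quad[of r] by (intro exI conjI) auto
    qed
  next
    have "continuous_on {0..T} g"
      using dg by (intro DERIV_continuous_on) auto
    then show "continuous_on {s..T} g" using s by (auto elim: continuous_on_subset)
  qed
  moreover have "\<phi> T = 0" using u by (simp add: \<phi>_def solves_backward_def)
  ultimately have "\<phi> s \<le> 0" by (simp add: g_def mult_le_0_iff)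
  then have "\<phi> s = 0" using \<phi>0[of s] by simp
  then show ?thesis by (simp add: \<phi>_def sum_nonneg_eq_0_iff)
qed

text \<open>Two solutions with the same terminal value differ by a solution ending at 0, so the
  definite description can be evaluated with whichever solution is at hand.\<close>

lemma backward_prop_eq:
  fixes L :: "real \<Rightarrow> 'a::finite \<Rightarrow> 'a \<Rightarrow> real"
  assumes L: "\<And>x y. continuous_on {0..T} (\<lambda>r. L r x y)"
    and lam: "continuous_on {0..T} lam" and H: "\<And>x. continuous_on {0..T} (\<lambda>r. H r x)"
    and u: "solves_backward lam L H T f u" and s: "s \<in> {0..T}"
  shows "backward_prop lam L H s T f = u s"
proof -
  have "v s = u s" if "solves_backward lam L H T f v" for v
  proof
    fix x
    have "solves_backward lam L H T (\<lambda>x. 0) (\<lambda>r x. v r x - u r x)"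
      using solves_backward_lincomb[OF that u, of 1 "-1"] by simp
    from solves_backward_zero_unique[OF L lam H this s, of x] show "v s x = u s x" by simp
  qed
  then show ?thesis unfolding backward_prop_def
    using u by (intro the_equality) blast+
qed

section \<open>The functional inequality\<close>

text \<open>The function \<open>\<phi>\<close> of the proof is increasing because its derivative is \<open>(z\<^bsup>q/2-1\<^esup> - \<theta>)\<^sup>2\<close>;
  optimising over \<open>\<theta>\<close> replaces the Cauchy-Schwarz inequality for the integrals of the derivatives.\<close>

lemma stroock_varopoulos:
  fixes a b q :: real
  assumes "0 < a" "0 < b" "1 < q"
  shows "4 * (q - 1) / q\<^sup>2 * (a powr (q / 2) - b powr (q / 2))\<^sup>2
           \<le> (a powr (q - 1) - b powr (q - 1)) * (a - b)"
  using assms(1,2)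
proof (induction a b rule: linorder_wlog)
  case (le b a)
  show ?case
  proof (cases "a = b")
    case False
    \<comment> \<open>\<open>A\<close> and \<open>B\<close> are the integrals over the interval from
      \<open>b\<close> to \<open>a\<close> of \<open>z powr (q - 2)\<close> and
      \<open>z powr (q / 2 - 1)\<close>, and \<open>D\<close> is its length; the claim is
      \<open>B\<^sup>2 \<le> A * D\<close>.\<close>
    define A where "A = (a powr (q - 1) - b powr (q - 1)) / (q - 1)"
    define B where "B = 2 / q * (a powr (q / 2) - b powr (q / 2))"
    define D where "D = a - b"
    have D: "D > 0" using False le by (simp add: D_def)
    \<comment> \<open>The minimiser of
      \<open>A - 2 * \<theta> * B + \<theta>\<^sup>2 * D\<close>.\<close>
    define \<theta> where "\<theta> = B / D"
    define \<phi> where "\<phi> z = z powr (q - 1) / (q - 1) - 2 * \<theta> * (2 / q * z powr (q / 2)) + \<theta>\<^sup>2 * z" for z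
    have "\<phi> b \<le> \<phi> a"
    proof (rule DERIV_nonneg_imp_nondecreasing[OF le(1)])
      fix z assume "b \<le> z"
      then have z: "z > 0" using le by simp
      have d1: "((\<lambda>z. z powr (q - 1) / (q - 1)) has_real_derivative z powr (q - 2)) (at z)"
        using DERIV_cdivide[OF has_real_derivative_powr[OF z, of "q - 1"], of "q - 1"] \<open>1 < q\<close> by simp
      have d2: "((\<lambda>z. 2 / q * z powr (q / 2)) has_real_derivative z powr (q / 2 - 1)) (at z)"
        using DERIV_cmult[OF has_real_derivative_powr[OF z, of "q / 2"], of "2 / q"] \<open>1 < q\<close> by simp
      have "(\<phi> has_real_derivative z powr (q - 2) - 2 * \<theta> * z powr (q / 2 - 1) + \<theta>\<^sup>2) (at z)"
        unfolding \<phi>_def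
        using DERIV_add[OF DERIV_diff[OF d1 DERIV_cmult[OF d2, of "2 * \<theta>"]] DERIV_cmult[OF DERIV_ident, of "\<theta>\<^sup>2" z]]
        by simp
      moreover have "z powr (q - 2) = (z powr (q / 2 - 1))\<^sup>2"
        using z by (simp add: power2_eq_square flip: powr_add)
      ultimately have "(\<phi> has_real_derivative (z powr (q / 2 - 1) - \<theta>)\<^sup>2) (at z)"
        by (simp add: power2_diff algebra_simps)
      then show "\<exists>y. DERIV \<phi> z :> y \<and> 0 \<le> y" by (meson zero_le_power2)
    qed
    then have "0 \<le> A - 2 * \<theta> * B + \<theta>\<^sup>2 * D"
      by (simp add: \<phi>_def A_def B_def D_def algebra_simps diff_divide_distrib)
    also have "\<dots> = A - B\<^sup>2 / D" using D by (simp add: \<theta>_def power2_eq_square field_simps)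
    finally have "B\<^sup>2 \<le> A * D" using D by (simp add: field_simps)
    then have "(q - 1) * B\<^sup>2 \<le> (q - 1) * (A * D)" using \<open>1 < q\<close> by (intro mult_left_mono) auto
    moreover have "(q - 1) * B\<^sup>2 = 4 * (q - 1) / q\<^sup>2 * (a powr (q / 2) - b powr (q / 2))\<^sup>2"
      unfolding B_def power_mult_distrib power_divide by simp
    moreover have "(q - 1) * (A * D) = (a powr (q - 1) - b powr (q - 1)) * (a - b)"
      using \<open>1 < q\<close> by (simp add: A_def D_def)
    ultimately have "4 * (q - 1) / q\<^sup>2 * (a powr (q / 2) - b powr (q / 2))\<^sup>2
        \<le> (a powr (q - 1) - b powr (q - 1)) * (a - b)" by simp
    then show ?thesis by (simp only: power2_commute[of "b powr (q / 2)"] minus_mult_minus[symmetric, of "b powr (q - 1) - _"] minus_diff_eq)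
  qed simp
next
  case (sym a b)
  then show ?case by (simp add: power2_commute algebra_simps)
qed

text \<open>The polarised form of the two expressions for the Dirichlet form. After expanding the
  product, vanishing row sums remove the terms \<open>h x * k x\<close>; detailed balance permits
  exchanging \<open>x\<close> and \<open>y\<close>, which removes \<open>h y * k y\<close> and
  identifies the two mixed terms.\<close>

lemma dirichlet_symmetrization:
  fixes m :: "'a::finite pmf"
  assumes Q: "q_matrix Q" and db: "detailed_balance m Q"
  shows "- (\<Sum>x\<in>UNIV. h x * gen Q k x * pmf m x)
    = 1 / 2 * (\<Sum>x\<in>UNIV. \<Sum>y\<in>UNIV. pmf m x * Q x y * ((h x - h y) * (k x - k y)))"
proof -
  have row: "(\<Sum>x\<in>UNIV. \<Sum>y\<in>UNIV. pmf m x * Q x y * g x) = 0" for g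
  proof -
    have "(\<Sum>y\<in>UNIV. pmf m x * Q x y * g x) = pmf m x * g x * (\<Sum>y\<in>UNIV. Q x y)" for x
      by (simp add: sum_distrib_left mult_ac)
    then show ?thesis using Q by (simp add: q_matrix_def)
  qed
  have swap: "(\<Sum>x\<in>UNIV. \<Sum>y\<in>UNIV. pmf m x * Q x y * g y x) = (\<Sum>x\<in>UNIV. \<Sum>y\<in>UNIV. pmf m x * Q x y * g x y)" for g
    using db unfolding detailed_balance_def by (subst sum.swap) simp
  have e: "pmf m x * Q x y * ((h x - h y) * (k x - k y)) = pmf m x * Q x y * (h x * k x)
      + pmf m x * Q x y * (h y * k y) - pmf m x * Q x y * (h x * k y) - pmf m x * Q x y * (h y * k x)" for x y
    by (simp add: algebra_simps)
  have "(\<Sum>x\<in>UNIV. \<Sum>y\<in>UNIV. pmf m x * Q x y * ((h x - h y) * (k x - k y)))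
      = - 2 * (\<Sum>x\<in>UNIV. \<Sum>y\<in>UNIV. pmf m x * Q x y * (h x * k y))"
    unfolding e sum_subtractf sum.distrib
    using row[of "\<lambda>x. h x * k x"] swap[of "\<lambda>x y. h x * k x"] swap[of "\<lambda>x y. h x * k y"] by simp
  also have "(\<Sum>x\<in>UNIV. \<Sum>y\<in>UNIV. pmf m x * Q x y * (h x * k y)) = (\<Sum>x\<in>UNIV. h x * gen Q k x * pmf m x)"
    by (simp add: gen_def sum_distrib_left sum_distrib_right mult_ac)
  finally show ?thesis by simp
qed

lemma expectation_finite: "measure_pmf.expectation (m :: 'a::finite pmf) g = (\<Sum>x\<in>UNIV. g x * pmf m x)"
  by (rule integral_measure_pmf_real) auto

lemma dirichlet_form_power_le:
  fixes m :: "'a::finite pmf"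
  assumes Q: "q_matrix Q" and db: "detailed_balance m Q" and u: "\<And>x. 0 < u x" and "1 < q"
  shows "4 * (q - 1) / q\<^sup>2 * dirichlet_form m Q (\<lambda>x. u x powr (q / 2))
      \<le> - (\<Sum>x\<in>UNIV. u x powr (q - 1) * gen Q u x * pmf m x)"
proof -
  \<comment> \<open>The weight \<open>pmf m x * Q x y\<close> is known to be nonnegative only off
    the diagonal; on the diagonal both sides are 0.\<close>
  have pt: "4 * (q - 1) / q\<^sup>2 * (pmf m x * Q x y * ((u x powr (q/2) - u y powr (q/2)) * (u x powr (q/2) - u y powr (q/2))))
      \<le> pmf m x * Q x y * ((u x powr (q - 1) - u y powr (q - 1)) * (u x - u y))" for x y
  proof (cases "x = y")
    case False
    then have "0 \<le> pmf m x * Q x y" using Q by (simp add: q_matrix_def)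
    from mult_left_mono[OF stroock_varopoulos[OF u u \<open>1 < q\<close>] this, of x y] show ?thesis
      by (simp add: power2_eq_square mult_ac)
  qed simp
  have "4 * (q - 1) / q\<^sup>2 * (\<Sum>x\<in>UNIV. \<Sum>y\<in>UNIV. pmf m x * Q x y
        * ((u x powr (q/2) - u y powr (q/2)) * (u x powr (q/2) - u y powr (q/2))))
      \<le> (\<Sum>x\<in>UNIV. \<Sum>y\<in>UNIV. pmf m x * Q x y * ((u x powr (q - 1) - u y powr (q - 1)) * (u x - u y)))"
    unfolding sum_distrib_left by (intro sum_mono pt[unfolded mult.assoc] pt)
  then show ?thesis
    unfolding dirichlet_form_def expectation_finite dirichlet_symmetrization[OF Q db] by simp
qed

text \<open>The logarithmic Sobolev inequality is applied to \<open>g = u powr (q / 2)\<close>, for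
  which \<open>F\<close> is the squared \<open>L\<^sup>2\<close> norm and the left side becomes an
  entropy of \<open>u powr q\<close>; then \<open>dirichlet_form_power_le\<close> bounds the form of
  \<open>g\<close>. The second conclusion will serve where the entropy term is negative.\<close>

lemma log_sobolev_power:
  fixes m :: "'a::finite pmf"
  assumes Q: "q_matrix Q" and db: "detailed_balance m Q" and ls: "log_sobolev m Q c" and "0 < c"
    and m: "\<And>x. 0 < pmf m x" and u: "\<And>x. 0 < u x" and "1 < q"
    and F: "F = (\<Sum>x\<in>UNIV. u x powr q * pmf m x)"
  shows "4 * (q - 1) / q\<^sup>2 * ((\<Sum>x\<in>UNIV. u x powr q * pmf m x * (q * ln (u x))) - F * ln F) / c
      \<le> - (\<Sum>x\<in>UNIV. u x powr (q - 1) * gen Q u x * pmf m x)"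
    and "0 \<le> - (\<Sum>x\<in>UNIV. u x powr (q - 1) * gen Q u x * pmf m x)"
proof -
  define g where "g x = u x powr (q / 2)" for x
  have g2: "(g x)\<^sup>2 = u x powr q" for x
    using u[of x] by (simp add: g_def power2_eq_square flip: powr_add)
  have g: "g x > 0" for x using u[of x] by (simp add: g_def)
  have "0 < u x powr q * pmf m x" for x
    using m[of x] u[of x] by simp
  then have Fp: "F > 0" unfolding F by (intro sum_pos) auto
  have "Lp_norm m 2 g = F powr (1 / 2)"
    using g g2 by (simp add: Lp_norm_def F less_imp_le)
  then have n: "Lp_norm m 2 g = sqrt F"
    using Fp by (simp add: powr_half_sqrt)
  have lnq: "ln ((g x / Lp_norm m 2 g)\<^sup>2) = q * ln (u x) - ln F" for x
    using Fp u[of x] by (simp add: n power_divide g2 ln_div ln_powr)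
  have "measure_pmf.expectation m (\<lambda>x. (g x)\<^sup>2 * ln ((g x / Lp_norm m 2 g)\<^sup>2))
      = (\<Sum>x\<in>UNIV. u x powr q * pmf m x * (q * ln (u x)) - u x powr q * pmf m x * ln F)"
    unfolding expectation_finite g2 lnq by (simp add: algebra_simps)
  also have "\<dots> = (\<Sum>x\<in>UNIV. u x powr q * pmf m x * (q * ln (u x))) - F * ln F"
    by (simp only: sum_subtractf F sum_distrib_right)
  finally have "(\<Sum>x\<in>UNIV. u x powr q * pmf m x * (q * ln (u x))) - F * ln F \<le> c * dirichlet_form m Q g"
    using ls[unfolded log_sobolev_def, rule_format, of g] by linarith
  then have "((\<Sum>x\<in>UNIV. u x powr q * pmf m x * (q * ln (u x))) - F * ln F) / c \<le> dirichlet_form m Q g"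
    by (subst pos_divide_le_eq[OF \<open>0 < c\<close>]) (simp only: mult.commute[of _ c])
  then have "4 * (q - 1) / q\<^sup>2 * (((\<Sum>x\<in>UNIV. u x powr q * pmf m x * (q * ln (u x))) - F * ln F) / c)
      \<le> 4 * (q - 1) / q\<^sup>2 * dirichlet_form m Q g"
    using \<open>1 < q\<close> by (intro mult_left_mono divide_nonneg_nonneg) simp_all
  also note le = dirichlet_form_power_le[OF Q db u \<open>1 < q\<close>, folded g_def]
  finally show "4 * (q - 1) / q\<^sup>2 * ((\<Sum>x\<in>UNIV. u x powr q * pmf m x * (q * ln (u x))) - F * ln F) / c
      \<le> - (\<Sum>x\<in>UNIV. u x powr (q - 1) * gen Q u x * pmf m x)" by simp
  have "0 \<le> pmf m x * Q x y * ((g x - g y) * (g x - g y))" for x y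
    using Q by (cases "x = y") (simp_all add: q_matrix_def)
  then have "0 \<le> (\<Sum>x\<in>UNIV. \<Sum>y\<in>UNIV. pmf m x * Q x y * ((g x - g y) * (g x - g y)))"
    by (simp only: sum_nonneg)
  then have "0 \<le> dirichlet_form m Q g"
    unfolding dirichlet_form_def expectation_finite dirichlet_symmetrization[OF Q db] by simp
  then have "0 \<le> 4 * (q - 1) / q\<^sup>2 * dirichlet_form m Q g" using \<open>1 < q\<close> by simp
  also note le
  finally show "0 \<le> - (\<Sum>x\<in>UNIV. u x powr (q - 1) * gen Q u x * pmf m x)" .
qed

section \<open>Derivative of the logarithmic norm in time and exponent\<close>

text \<open>The exponent \<open>q = 1 + exp (4 * y)\<close> satisfies
  \<open>dq/dy = 4 * (q - 1)\<close>. This makes the \<open>y\<close>-derivative equal to the left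
  side of \<open>log_sobolev_power\<close> with the division by \<open>c\<close> replaced by one by
  \<open>F\<close>, and makes \<open>y\<close> run at speed \<open>lam / C\<close> without further
  factors.\<close>

lemma Lp_log_has_derivative:
  fixes u m :: "real \<Rightarrow> 'a::finite \<Rightarrow> real" and y :: real
  defines "q \<equiv> 1 + exp (4 * y)"
  assumes "r \<in> S"
    and du: "\<And>x. ((\<lambda>r. u r x) has_real_derivative u' x) (at r within S)"
    and dm: "\<And>x. ((\<lambda>r. m r x) has_real_derivative - h x * m r x) (at r within S)"
    and pos: "\<And>x. 0 < u r x" "\<And>x. 0 < m r x"
    and F: "F = (\<Sum>x\<in>UNIV. u r x powr q * m r x)"
  shows "((\<lambda>z. ln (\<Sum>x\<in>UNIV. u (fst z) x powr (1 + exp (4 * snd z)) * m (fst z) x) / (1 + exp (4 * snd z)))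
    has_derivative (\<lambda>d. ((\<Sum>x\<in>UNIV. u r x powr (q - 1) * u' x * m r x)
                          - (\<Sum>x\<in>UNIV. u r x powr q * m r x * h x) / q) / F * fst d
       + (4 * (q - 1) / q\<^sup>2 * ((\<Sum>x\<in>UNIV. u r x powr q * m r x * (q * ln (u r x))) - F * ln F) / F) * snd d))
    (at (r, y) within S \<times> UNIV)"
proof -
  have lift: "((\<lambda>z. g (fst z)) has_derivative (\<lambda>d. g' * fst d)) (at (r, y) within S \<times> UNIV)"
    if "(g has_real_derivative g') (at r within S)" for g g'
    using that \<open>r \<in> S\<close> unfolding has_field_derivative_def
    by (intro has_derivative_in_compose[of fst fst "(r, y)" "S \<times> (UNIV::real set)" g "\<lambda>d. g' * d"])
       (auto intro!: derivative_eq_intros elim: has_derivative_subset)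
  have q: "q > 1" by (simp add: q_def)
  have "0 < u r x powr q * m r x" for x
    using pos(1)[of x] pos(2)[of x] by simp
  then have Fp: "F > 0" unfolding F by (intro sum_pos) auto
  have powr: "u r x powr (q - 1) = u r x powr q / u r x" for x
    using pos(1)[of x] by (simp add: powr_diff)
  have dF: "((\<lambda>z. \<Sum>x\<in>UNIV. u (fst z) x powr (1 + exp (4 * snd z)) * m (fst z) x) has_derivative
     (\<lambda>d. \<Sum>x\<in>UNIV. (u r x powr q * ((4 * (q - 1) * snd d) * ln (u r x) + (u' x * fst d) * q / u r x)) * m r x
        + u r x powr q * (- h x * m r x * fst d)))
    (at (r, y) within S \<times> UNIV)"
    using \<open>r \<in> S\<close> pos
    by (auto intro!: derivative_eq_intros lift[OF du] lift[OF dm] ext sum.cong simp: q_def algebra_simps)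
  have dQ: "((\<lambda>z. 1 + exp (4 * snd z)) has_derivative (\<lambda>d. 4 * (q - 1) * snd d)) (at (r, y) within S \<times> UNIV)"
    by (auto intro!: derivative_eq_intros ext simp: q_def)
  define D where "D d = (\<Sum>x\<in>UNIV. (u r x powr q * ((4 * (q - 1) * snd d) * ln (u r x) + (u' x * fst d) * q / u r x)) * m r x
        + u r x powr q * (- h x * m r x * fst d))" for d :: "real \<times> real"
  have dL: "((\<lambda>z. ln (\<Sum>x\<in>UNIV. u (fst z) x powr (1 + exp (4 * snd z)) * m (fst z) x)) has_derivative
      (\<lambda>d. D d * inverse F)) (at (r, y) within S \<times> UNIV)"
    by (rule DERIV_compose_FDERIV[OF _ dF[folded D_def]]) (use DERIV_ln[OF Fp] in \<open>simp add: F q_def\<close>)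
  have F': "(\<Sum>x\<in>UNIV. u (fst (r, y)) x powr (1 + exp (4 * snd (r, y))) * m (fst (r, y)) x) = F"
    "1 + exp (4 * snd (r, y)) = q"
    by (simp_all add: F q_def)
  \<comment> \<open>The differential of the sum, regrouped into its \<open>y\<close> part and its
    \<open>r\<close> part so that the quotient rule can be compared with the claim.\<close>
  have D: "D d = 4 * (q - 1) / q * (\<Sum>x\<in>UNIV. u r x powr q * m r x * (q * ln (u r x))) * snd d
       + (q * (\<Sum>x\<in>UNIV. u r x powr (q - 1) * u' x * m r x) - (\<Sum>x\<in>UNIV. u r x powr q * m r x * h x)) * fst d"
    for d :: "real \<times> real"
    using q unfolding powr D_def
    by (simp add: sum_distrib_left sum_distrib_right sum_subtractf[symmetric] sum.distrib[symmetric] left_diff_distrib)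
       (intro sum.cong refl, simp add: field_simps)
  have "((\<lambda>z. ln (\<Sum>x\<in>UNIV. u (fst z) x powr (1 + exp (4 * snd z)) * m (fst z) x) / (1 + exp (4 * snd z)))
      has_derivative (\<lambda>d. ((D d * inverse F) * q - ln F * (4 * (q - 1) * snd d)) / (q * q)))
      (at (r, y) within S \<times> UNIV)"
    using has_derivative_divide'[OF dL dQ, unfolded F'] q by (simp add: F)
  then show ?thesis
  proof (rule has_derivative_eq_rhs, intro ext)
    fix d :: "real \<times> real"
    define X where "X = (\<Sum>x\<in>UNIV. u r x powr q * m r x * (q * ln (u r x)))"
    define Y where "Y = (\<Sum>x\<in>UNIV. u r x powr (q - 1) * u' x * m r x)"
    define W where "W = (\<Sum>x\<in>UNIV. u r x powr q * m r x * h x)"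
    show "((D d * inverse F) * q - ln F * (4 * (q - 1) * snd d)) / (q * q)
      = (Y - W / q) / F * fst d + (4 * (q - 1) / q\<^sup>2 * (X - F * ln F) / F) * snd d"
      unfolding D X_def[symmetric] Y_def[symmetric] W_def[symmetric]
      using q Fp by (simp add: field_simps power2_eq_square)
  qed
qed

section \<open>Hypercontractivity\<close>

lemma neg_dlog_properties:
  fixes \<mu> :: "real \<Rightarrow> 'a::finite pmf"
  assumes pos: "\<And>t x. 0 \<le> t \<Longrightarrow> 0 < pmf (\<mu> t) x"
    and eq: "\<And>t x. 0 \<le> t \<Longrightarrow> pmf (\<mu> t) x = 1 / Z t * exp (- \<H> t x) * pmf (\<mu> 0) x"
    and C1: "\<And>x. C1_on_nonneg (\<lambda>t. \<H> t x)"
  shows "continuous_on {0..} (\<lambda>t. neg_dlog \<mu> t x)"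
    and "0 \<le> t \<Longrightarrow> ((\<lambda>r. pmf (\<mu> r) x) has_real_derivative - neg_dlog \<mu> t x * pmf (\<mu> t) x) (at t within {0..})"
proof -
  obtain h where h: "\<And>x t. t \<ge> 0 \<Longrightarrow> ((\<lambda>t. \<H> t x) has_real_derivative h x t) (at t within {0..})"
    "\<And>x. continuous_on {0..} (h x)"
    using C1 unfolding C1_on_nonneg_def by metis
  have Hc: "continuous_on {0..} (\<lambda>t. \<H> t x)" for x
    using h(1) by (intro DERIV_continuous_on) auto
  define N where "N t = (\<Sum>y\<in>UNIV. exp (- \<H> t y) * pmf (\<mu> 0) y)" for t
  have N: "N t > 0" for t
    unfolding N_def using pos[of 0] by (intro sum_pos) auto
  \<comment> \<open>Total mass 1 identifies \<open>Z t\<close> with \<open>N t\<close>, whose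
    smoothness is inherited from \<open>\<H>\<close>.\<close>
  have Z: "1 / Z t = 1 / N t" if "0 \<le> t" for t
  proof -
    have "1 = (\<Sum>y\<in>UNIV. pmf (\<mu> t) y)" by (simp add: sum_pmf_eq_1)
    also have "\<dots> = 1 / Z t * N t"
      unfolding N_def by (subst eq[OF that]) (simp add: sum_distrib_left sum_divide_distrib mult_ac)
    finally show ?thesis using N[of t] by (simp add: field_simps)
  qed
  define d where "d x t = - h x t + (\<Sum>y\<in>UNIV. h y t * exp (- \<H> t y) * pmf (\<mu> 0) y) / N t" for x t
  have ln_eq: "ln (pmf (\<mu> t) x) = ln (pmf (\<mu> 0) x) - \<H> t x - ln (N t)" if "0 \<le> t" for t x
    using N[of t] pos[of 0 x] by (subst eq[OF that], subst Z[OF that]) (simp add: ln_mult ln_div)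
  have dN: "(N has_real_derivative - (\<Sum>y\<in>UNIV. h y t * exp (- \<H> t y) * pmf (\<mu> 0) y)) (at t within {0..})"
    if "0 \<le> t" for t
    unfolding N_def by (auto intro!: derivative_eq_intros h(1)[OF that] simp: sum_negf mult_ac)
  have dln: "((\<lambda>r. ln (pmf (\<mu> r) x)) has_real_derivative d x t) (at t within {0..})" if "0 \<le> t" for t x
  proof -
    have "((\<lambda>r. ln (pmf (\<mu> 0) x) - \<H> r x - ln (N r)) has_real_derivative d x t) (at t within {0..})"
      using N[of t] by (auto intro!: derivative_eq_intros h(1)[OF that] dN[OF that] simp: d_def field_simps)
    then show ?thesis
      by (rule has_field_derivative_transform_within[where d = 1, OF _ _ _ ln_eq[symmetric]]) (use that in auto)
  qed
  have nd: "neg_dlog \<mu> t x = - d x t" if "0 \<le> t" for t x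
  proof -
    \<comment> \<open>The filter is nontrivial also at \<open>t = 0\<close>, so the one-sided
      derivative there is unique and \<open>vector_derivative\<close> returns it.\<close>
    have "t islimpt {0..}"
      by (rule islimpt_subset[of t "{t..t+1}"]) (use that in auto)
    then have "at t within {0..} \<noteq> bot" by (simp add: trivial_limit_within)
    from vector_derivative_within[OF this dln[OF that, of x, unfolded has_real_derivative_iff_has_vector_derivative]]
    show ?thesis by (simp add: neg_dlog_def)
  qed
  have Nc: "continuous_on {0..} N"
    using dN by (intro DERIV_continuous_on) auto
  have N_ne: "\<forall>t\<in>{0..}. N t \<noteq> 0"
    using N by (metis less_irrefl)
  have "continuous_on {0..} (\<lambda>t. - d x t)"
    unfolding d_def using N_ne by (intro continuous_intros h(2) Hc Nc)
  then show "continuous_on {0..} (\<lambda>t. neg_dlog \<mu> t x)"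
    by (rule continuous_on_eq) (simp add: nd)
  assume t: "0 \<le> t"
  have "((\<lambda>r. exp (ln (pmf (\<mu> r) x))) has_real_derivative d x t * pmf (\<mu> t) x) (at t within {0..})"
    using DERIV_chain2[OF DERIV_exp dln[OF t, of x]] pos[OF t, of x] by (simp add: mult.commute)
  then have "((\<lambda>r. pmf (\<mu> r) x) has_real_derivative d x t * pmf (\<mu> t) x) (at t within {0..})"
    by (rule has_field_derivative_transform_within[where d = 1]) (use t pos in auto)
  then show "((\<lambda>r. pmf (\<mu> r) x) has_real_derivative - neg_dlog \<mu> t x * pmf (\<mu> t) x) (at t within {0..})"
    by (simp add: nd[OF t])
qed

section \<open>Reducing the speed to a prescribed integral\<close>

text \<open>The integral of \<open>g\<close> may be infinite. In that case the truncations
  \<open>min g n\<close> have finite integrals, which exceed \<open>c\<close> for large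
  \<open>n\<close> by monotone convergence. A function of finite integral \<open>I \<ge> c\<close>
  is then scaled by \<open>c / I\<close>, so the curve ends exactly at the exponent
  \<open>q\<close>.\<close>

lemma integrable_minorant_with_integral:
  fixes g :: "real \<Rightarrow> real"
  assumes meas: "g \<in> borel_measurable (lebesgue_on {s..t})" and nonneg: "\<And>r. r \<in> {s..t} \<Longrightarrow> 0 \<le> g r"
    and ge: "(\<integral>\<^sup>+r\<in>{s..t}. ennreal (g r) \<partial>lebesgue) \<ge> ennreal c" and "0 \<le> c"
  obtains a where "a integrable_on {s..t}" "\<And>r. r \<in> {s..t} \<Longrightarrow> 0 \<le> a r \<and> a r \<le> g r" "integral {s..t} a = c"
proof -
  define G where "G r = (if r \<in> {s..t} then g r else 0)" for r
  have Gm [measurable]: "G \<in> borel_measurable lebesgue"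
    unfolding G_def by (rule borel_measurable_if_I[OF meas]) simp
  have G0: "0 \<le> G r" for r using nonneg by (simp add: G_def)
  have Gnn: "(\<integral>\<^sup>+r. ennreal (G r) \<partial>lebesgue) \<ge> ennreal c"
  proof -
    have "(\<lambda>r. ennreal (g r) * indicator {s..t} r) = (\<lambda>r. ennreal (G r))"
      by (auto simp: G_def split: split_indicator)
    with ge show ?thesis by simp
  qed
  have "\<exists>b. b \<in> borel_measurable lebesgue \<and> (\<forall>r. 0 \<le> b r \<and> b r \<le> G r) \<and>
      (\<integral>\<^sup>+r. ennreal (b r) \<partial>lebesgue) \<ge> ennreal c \<and> (\<integral>\<^sup>+r. ennreal (b r) \<partial>lebesgue) < \<infinity>"
  proof (cases "(\<integral>\<^sup>+r. ennreal (G r) \<partial>lebesgue) < \<infinity>")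
    case True
    then show ?thesis using Gnn G0 by (intro exI[of _ G]) auto
  next
    case False
    define b where "b n r = min (G r) (real n)" for n r
    have bm [measurable]: "b n \<in> borel_measurable lebesgue" for n
      unfolding b_def by measurable
    have SUPb: "(SUP n. ennreal (b n r)) = ennreal (G r)" for r
    proof (rule antisym)
      show "(SUP n. ennreal (b n r)) \<le> ennreal (G r)"
        by (intro SUP_least ennreal_leI) (simp add: b_def)
      obtain n where "G r \<le> real n" using real_arch_simple by blast
      then have "G r = b n r" by (simp add: b_def)
      then show "ennreal (G r) \<le> (SUP n. ennreal (b n r))"
        by (metis SUP_upper UNIV_I)
    qed
    have "incseq (\<lambda>n r. ennreal (b n r))"
      by (auto simp: incseq_def le_fun_def b_def intro!: ennreal_leI)
    then have "(\<integral>\<^sup>+r. (SUP n. ennreal (b n r)) \<partial>lebesgue) = (SUP n. \<integral>\<^sup>+r. ennreal (b n r) \<partial>lebesgue)"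
      by (intro nn_integral_monotone_convergence_SUP) auto
    moreover have "(\<integral>\<^sup>+r. ennreal (G r) \<partial>lebesgue) = top"
      using False top.not_eq_extremum by (metis infinity_ennreal_def)
    ultimately have "ennreal c < (SUP n. \<integral>\<^sup>+r. ennreal (b n r) \<partial>lebesgue)"
      unfolding SUPb by simp
    then obtain n where n: "ennreal c < (\<integral>\<^sup>+r. ennreal (b n r) \<partial>lebesgue)"
      by (auto simp: less_SUP_iff)
    have "(\<integral>\<^sup>+r. ennreal (b n r) \<partial>lebesgue) \<le> (\<integral>\<^sup>+r. ennreal (real n) * indicator {s..t} r \<partial>lebesgue)"
      by (intro nn_integral_mono) (auto simp: b_def G_def split: split_indicator intro!: ennreal_leI)
    also have "\<dots> < \<infinity>"
      by (subst nn_integral_cmult_indicator) (auto simp: ennreal_mult_less_top emeasure_lborel_Icc_eq)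
    finally show ?thesis
      using n G0 by (intro exI[of _ "b n"]) (auto simp: b_def)
  qed
  then obtain b where b: "b \<in> borel_measurable lebesgue" "\<And>r. 0 \<le> b r" "\<And>r. b r \<le> G r"
    "(\<integral>\<^sup>+r. ennreal (b r) \<partial>lebesgue) \<ge> ennreal c" "(\<integral>\<^sup>+r. ennreal (b r) \<partial>lebesgue) < \<infinity>"
    by blast
  obtain I where I: "(\<integral>\<^sup>+r. ennreal (b r) \<partial>lebesgue) = ennreal I" "0 \<le> I"
    using b(5) by (cases "\<integral>\<^sup>+r. ennreal (b r) \<partial>lebesgue") auto
  have cI: "c \<le> I" using b(4) I \<open>0 \<le> c\<close> by simp
  have "(b has_integral I) UNIV"
    using has_integral_iff_nn_integral_lebesgue[of b I] b I by simp
  moreover have "b = (\<lambda>r. if r \<in> {s..t} then b r else 0)"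
  proof
    fix r show "b r = (if r \<in> {s..t} then b r else 0)"
      using b(2,3)[of r] by (auto simp: G_def)
  qed
  ultimately have bi: "(b has_integral I) {s..t}"
    using has_integral_restrict_UNIV[of "{s..t}" b I] by simp
  \<comment> \<open>If \<open>I = 0\<close> then \<open>c = 0\<close> as well, and
    \<open>c / I = 0\<close> still gives the right integral.\<close>
  define a where "a r = (c / I) * b r" for r
  have ai: "(a has_integral c) {s..t}"
    using has_integral_mult_right[OF bi, of "c / I"] cI \<open>0 \<le> c\<close> unfolding a_def
    by (cases "I = 0") auto
  moreover have "0 \<le> a r \<and> a r \<le> g r" if "r \<in> {s..t}" for r
  proof -
    have "a r \<le> 1 * b r" unfolding a_def
      using cI \<open>0 \<le> c\<close> I(2) b(2)[of r] by (intro mult_right_mono) (auto simp: divide_le_eq_1)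
    then show ?thesis using b(2,3)[of r] that \<open>0 \<le> c\<close> I(2) by (simp add: a_def G_def)
  qed
  ultimately show thesis by (intro that[of a]) (auto simp: integral_unique)
qed

section \<open>The estimate for positive solutions\<close>

text \<open>Both equations together give \<open>F * \<Psi>r = lam * E + (1 - 1/q) * W\<close>, where
  \<open>E\<close> is the energy term and \<open>W\<close> the integral of \<open>H\<close> against
  \<open>u powr q\<close>. The energy pays for the growth of the exponent via
  \<open>log_sobolev_power\<close>; the \<open>W\<close> term costs at most
  \<open>M * F\<close>.\<close>

lemma hypercontractive_positive:
  fixes \<mu> :: "real \<Rightarrow> 'a::finite pmf" and H u :: "real \<Rightarrow> 'a \<Rightarrow> real"
  assumes "s \<le> t"
    and upos: "\<And>r x. r \<in> {s..t} \<Longrightarrow> 0 < u r x"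
    and du: "\<And>r x. r \<in> {s..t} \<Longrightarrow> ((\<lambda>r. u r x) has_real_derivative
          - (lam r * gen (L r) (u r) x - H r x * u r x)) (at r within {s..t})"
    and dm: "\<And>r x. r \<in> {s..t} \<Longrightarrow> ((\<lambda>r. pmf (\<mu> r) x) has_real_derivative - H r x * pmf (\<mu> r) x) (at r within {s..t})"
    and mpos: "\<And>r x. r \<in> {s..t} \<Longrightarrow> 0 < pmf (\<mu> r) x"
    and Hc: "\<And>x. continuous_on {s..t} (\<lambda>r. H r x)"
    and Lc: "\<And>x y. continuous_on {s..t} (\<lambda>r. L r x y)" and lamc: "continuous_on {s..t} lam"
    and lam: "\<And>r. r \<in> {s..t} \<Longrightarrow> 0 \<le> lam r"
    and Q: "\<And>r. r \<in> {s..t} \<Longrightarrow> q_matrix (L r)"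
    and db: "\<And>r. r \<in> {s..t} \<Longrightarrow> detailed_balance (\<mu> r) (L r)"
    and ls: "\<And>r. r \<in> {s..t} \<Longrightarrow> log_sobolev (\<mu> r) (L r) (C r)"
    and C: "\<And>r. r \<in> {s..t} \<Longrightarrow> 0 < C r"
    and M: "M integrable_on {s..t}" "\<And>r. r \<in> {s..t} \<Longrightarrow> 0 \<le> M r" "\<And>r x. r \<in> {s..t} \<Longrightarrow> - H r x \<le> M r"
    and a: "a integrable_on {s..t}" "\<And>r. r \<in> {s..t} \<Longrightarrow> 0 \<le> a r \<and> a r \<le> lam r / C r"
    and p: "1 < p" "p \<le> q" and int_a: "integral {s..t} a = 1 / 4 * ln ((q - 1) / (p - 1))"
  shows "Lp_norm (\<mu> s) q (u s) \<le> exp (integral {s..t} M) * Lp_norm (\<mu> t) p (u t)"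
proof -
  define q' where "q' y = 1 + exp (4 * y)" for y :: real
  define F where "F r y = (\<Sum>x\<in>UNIV. u r x powr q' y * pmf (\<mu> r) x)" for r y
  define X where "X r y = (\<Sum>x\<in>UNIV. u r x powr q' y * pmf (\<mu> r) x * (q' y * ln (u r x)))" for r y
  define Y where "Y r y = (\<Sum>x\<in>UNIV. u r x powr (q' y - 1)
      * (- (lam r * gen (L r) (u r) x - H r x * u r x)) * pmf (\<mu> r) x)" for r y
  define W where "W r y = (\<Sum>x\<in>UNIV. u r x powr q' y * pmf (\<mu> r) x * H r x)" for r y
  define \<Psi> where "\<Psi> r y = ln (F r y) / q' y" for r y
  define \<Psi>r where "\<Psi>r r y = (Y r y - W r y / q' y) / F r y" for r y
  define \<Psi>y where "\<Psi>y r y = 4 * (q' y - 1) / (q' y)\<^sup>2 * (X r y - F r y * ln (F r y)) / F r y" for r y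
  have q': "q' y > 1" for y by (simp add: q'_def)
  have "0 < u r x powr q' y * pmf (\<mu> r) x" if "r \<in> {s..t}" for r x y
    using upos[OF that, of x] mpos[OF that, of x] by simp
  then have Fpos: "F r y > 0" if "r \<in> {s..t}" for r y
    unfolding F_def using that by (intro sum_pos) auto
  have uc: "continuous_on {s..t} (\<lambda>r. u r x)" for x
    using du by (rule DERIV_continuous_on)
  have mc: "continuous_on {s..t} (\<lambda>r. pmf (\<mu> r) x)" for x
    using dm by (rule DERIV_continuous_on)
  have une: "u r x \<noteq> 0" if "r \<in> {s..t}" for r x using upos[OF that, of x] by simp
  have gc: "continuous_on {s..t} (\<lambda>r. gen (L r) (u r) x)" for x
    by (intro continuous_on_gen Lc uc)
  have pc: "continuous_on {s..t} (\<lambda>r. u r x powr z)" for x z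
    using une by (intro continuous_on_powr uc continuous_on_const) auto
  have lc: "continuous_on {s..t} (\<lambda>r. ln (u r x))" for x
    using une by (intro continuous_on_ln uc) auto
  have Fc: "continuous_on {s..t} (\<lambda>r. F r y)" for y
    unfolding F_def by (intro continuous_intros pc mc)
  have Fne: "\<forall>r\<in>{s..t}. F r y \<noteq> 0" for y using Fpos by (metis less_irrefl)
  have \<Psi>rc: "continuous_on {s..t} (\<lambda>r. \<Psi>r r y)" for y
    unfolding \<Psi>r_def Y_def W_def divide_inverse[of _ "q' y"]
    by (intro continuous_on_divide continuous_intros pc mc gc uc Hc lamc Fc Fne)
  have \<Psi>yc: "continuous_on {s..t} (\<lambda>r. \<Psi>y r y)" for y
    unfolding \<Psi>y_def X_def
    by (intro continuous_on_divide continuous_on_ln continuous_intros pc mc lc Fc Fne)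
  have D: "((\<lambda>z. \<Psi> (fst z) (snd z)) has_derivative (\<lambda>h. \<Psi>r r y * fst h + \<Psi>y r y * snd h))
      (at (r, y) within {s..t} \<times> UNIV)" if r: "r \<in> {s..t}" for r y
    using Lp_log_has_derivative[of r "{s..t}" u _ "\<lambda>r x. pmf (\<mu> r) x" "H r" "F r y" y,
        OF r du[OF r] dm[OF r] upos[OF r] mpos[OF r]]
    by (simp add: \<Psi>_def \<Psi>r_def \<Psi>y_def F_def X_def Y_def W_def q'_def)
  have ineq: "a r * \<Psi>y r y \<le> \<Psi>r r y + M r" if r: "r \<in> {s..t}" for r y
  proof -
    define E where "E = - (\<Sum>x\<in>UNIV. u r x powr (q' y - 1) * gen (L r) (u r) x * pmf (\<mu> r) x)"
    note LS = log_sobolev_power[OF Q[OF r] db[OF r] ls[OF r] C[OF r] mpos[OF r] upos[OF r] q'[of y] F_def,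
        folded E_def, folded X_def]
    have F: "F r y > 0" by (rule Fpos[OF r])
    have Y: "Y r y = lam r * E + W r y"
    proof -
      have "u r x powr (q' y - 1) * u r x = u r x powr q' y" for x
        using upos[OF r, of x] by (simp add: powr_diff)
      then have "u r x powr (q' y - 1) * (- (lam r * gen (L r) (u r) x - H r x * u r x)) * pmf (\<mu> r) x
          = - (lam r * (u r x powr (q' y - 1) * gen (L r) (u r) x * pmf (\<mu> r) x))
            + u r x powr q' y * pmf (\<mu> r) x * H r x" for x
        by (simp add: algebra_simps)
      then show ?thesis
        by (simp add: Y_def W_def E_def sum.distrib sum_subtractf sum_negf sum_distrib_left)
    qed
    have "- W r y \<le> M r * F r y"
    proof -
      have "u r x powr q' y * pmf (\<mu> r) x * (- H r x) \<le> u r x powr q' y * pmf (\<mu> r) x * M r" for x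
        using M(3)[OF r] by (intro mult_left_mono) auto
      then have "(\<Sum>x\<in>UNIV. u r x powr q' y * pmf (\<mu> r) x * (- H r x)) \<le> (\<Sum>x\<in>UNIV. u r x powr q' y * pmf (\<mu> r) x * M r)"
        by (intro sum_mono)
      then show ?thesis by (simp add: W_def F_def sum_negf sum_distrib_left mult_ac)
    qed
    \<comment> \<open>One \<open>W\<close> comes from the potential in the equation for
      \<open>u\<close>, and \<open>- W / q\<close> from the evolution of the measure. The resulting
      factor \<open>1 - 1 / q\<close> lies in \<open>[0, 1]\<close> and is bounded by 1, using
      \<open>M \<ge> 0\<close>.\<close>
    then have "(1 - 1 / q' y) * - W r y \<le> (1 - 1 / q' y) * (M r * F r y)"
      using q'[of y] by (intro mult_left_mono) auto
    also have "\<dots> \<le> 1 * (M r * F r y)"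
      using q'[of y] M(2)[OF r] F by (intro mult_right_mono) auto
    finally have W: "W r y / q' y - W r y \<le> M r * F r y" by (simp add: algebra_simps)
    define T where "T = 4 * (q' y - 1) / (q' y)\<^sup>2 * (X r y - F r y * ln (F r y))"
    have TE: "T / C r \<le> E" "0 \<le> E" using LS by (simp_all add: T_def)
    \<comment> \<open>For \<open>T \<ge> 0\<close>, lowering the speed from
      \<open>lam r / C r\<close> to \<open>a r\<close> only helps; for \<open>T < 0\<close> the left
      side is nonpositive and the energy nonnegative.\<close>
    have "a r * T \<le> lam r * E"
    proof (cases "T \<ge> 0")
      case True
      then have "a r * T \<le> lam r / C r * T" using a(2)[OF r] by (intro mult_right_mono) auto
      also have "\<dots> = lam r * (T / C r)" by simp
      also have "\<dots> \<le> lam r * E" using TE lam[OF r] by (intro mult_left_mono) auto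
      finally show ?thesis .
    next
      case False
      then have "a r * T \<le> 0" using a(2)[OF r] by (intro mult_nonneg_nonpos) auto
      also have "0 \<le> lam r * E" using TE lam[OF r] by simp
      finally show ?thesis .
    qed
    with W have "a r * T \<le> (Y r y - W r y / q' y) + M r * F r y" by (simp add: Y)
    then have "a r * T / F r y \<le> ((Y r y - W r y / q' y) + M r * F r y) / F r y"
      using F by (intro divide_right_mono) auto
    then show ?thesis
      unfolding \<Psi>r_def \<Psi>y_def T_def[symmetric] times_divide_eq_right
      using F by (simp add: add_divide_distrib)
  qed
  \<comment> \<open>Solves \<open>1 + exp (4 * y) = p\<close>. The integral of \<open>a\<close>
    carries it to \<open>ln (q - 1) / 4\<close>, which corresponds to \<open>q\<close>.\<close>
  define y0 where "y0 = ln (p - 1) / 4"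
  have main: "\<Psi> s (y0 + integral {s..t} a) \<le> \<Psi> t y0 + integral {s..t} M"
    using transport_monotone[OF \<open>s \<le> t\<close> D \<Psi>rc \<Psi>yc a(1) _ M(1) ineq] a(2) by blast
  have yq: "y0 + integral {s..t} a = ln (q - 1) / 4"
  proof -
    have "ln ((q - 1) / (p - 1)) = ln (q - 1) - ln (p - 1)"
      using p by (simp add: ln_div)
    then show ?thesis unfolding y0_def int_a by linarith
  qed
  have Lp: "Lp_norm (\<mu> r) (q' y) (u r) = exp (\<Psi> r y)" if "r \<in> {s..t}" for r y
  proof -
    have "Lp_norm (\<mu> r) (q' y) (u r) = F r y powr (1 / q' y)"
      using upos[OF that] by (simp add: Lp_norm_def F_def less_imp_le)
    also have "\<dots> = exp (\<Psi> r y)" using Fpos[OF that, of y] by (simp add: powr_def \<Psi>_def)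
    finally show ?thesis .
  qed
  have "q' (ln (q - 1) / 4) = q" "q' y0 = p" using p by (simp_all add: q'_def y0_def)
  then have "Lp_norm (\<mu> s) q (u s) = exp (\<Psi> s (ln (q - 1) / 4))" "Lp_norm (\<mu> t) p (u t) = exp (\<Psi> t y0)"
    using Lp[of s "ln (q - 1) / 4"] Lp[of t y0] \<open>s \<le> t\<close> by auto
  then show ?thesis using main by (simp add: yq add.commute flip: exp_add)
qed

section \<open>Passing from positive to arbitrary terminal functions\<close>

lemma Lp_norm_mono:
  assumes "\<And>x. \<bar>f x\<bar> \<le> \<bar>g x\<bar>" "0 < p"
  shows "Lp_norm m p f \<le> Lp_norm m p g"
  unfolding Lp_norm_def
  using assms by (intro powr_mono2 sum_mono mult_right_mono sum_nonneg) auto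

lemma Lp_norm_add_const_tendsto:
  assumes "1 < p"
  shows "((\<lambda>\<epsilon>. Lp_norm m p (\<lambda>x. f x + \<epsilon>)) \<longlongrightarrow> Lp_norm m p f) (at_right 0)"
proof -
  have "((\<lambda>\<epsilon>. \<Sum>x\<in>UNIV. \<bar>f x + \<epsilon>\<bar> powr p * pmf m x) \<longlongrightarrow> (\<Sum>x\<in>UNIV. \<bar>f x + 0\<bar> powr p * pmf m x)) (at_right 0)"
    \<comment> \<open>Where \<open>f\<close> vanishes the base tends to 0, and continuity of the
      power there rests on the positive exponent.\<close>
    using \<open>1 < p\<close> by (intro tendsto_intros tendsto_powr') auto
  then have "((\<lambda>\<epsilon>. (\<Sum>x\<in>UNIV. \<bar>f x + \<epsilon>\<bar> powr p * pmf m x) powr (1 / p))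
      \<longlongrightarrow> (\<Sum>x\<in>UNIV. \<bar>f x + 0\<bar> powr p * pmf m x) powr (1 / p)) (at_right 0)"
    using \<open>1 < p\<close> by (intro tendsto_powr' tendsto_const) (auto intro!: always_eventually sum_nonneg)
  then show ?thesis by (simp add: Lp_norm_def)
qed

lemma continuous_on_MAX:
  fixes g :: "real \<Rightarrow> 'a::finite \<Rightarrow> real"
  assumes "\<And>x. continuous_on S (\<lambda>r. g r x)"
  shows "continuous_on S (\<lambda>r. MAX x. g r x)"
proof -
  have "continuous_on S (\<lambda>r. Max (g r ` A))" if "finite A" "A \<noteq> {}" for A
    using that by (induction rule: finite_ne_induct) (auto intro!: continuous_intros assms)
  from this[of UNIV] show ?thesis by simp
qed

theorem theorem11:
  fixes \<mu> :: "real \<Rightarrow> 'a::finite pmf"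
    and \<H> :: "real \<Rightarrow> 'a \<Rightarrow> real"
    and Z lam C :: "real \<Rightarrow> real"
    and L :: "real \<Rightarrow> 'a \<Rightarrow> 'a \<Rightarrow> real"
    and p q s t :: real
    and f :: "'a \<Rightarrow> real"
  assumes "\<And>t x. 0 \<le> t \<Longrightarrow> 0 < pmf (\<mu> t) x"
    and "\<And>t x. 0 \<le> t \<Longrightarrow> pmf (\<mu> t) x = 1 / Z t * exp (- \<H> t x) * pmf (\<mu> 0) x"
    and "\<And>x. C1_on_nonneg (\<lambda>t. \<H> t x)"
    and "\<And>t. 0 \<le> t \<Longrightarrow> q_matrix (L t)"
    and "\<And>x y. continuous_on {0..} (\<lambda>t. L t x y)"
    and "\<And>t. 0 \<le> t \<Longrightarrow> detailed_balance (\<mu> t) (L t)"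
    and "continuous_on {0..} lam"
    and "\<And>t. 0 \<le> t \<Longrightarrow> 0 < lam t"
    and "C \<in> borel_measurable (lebesgue_on {0..})"
    and "\<And>t. 0 \<le> t \<Longrightarrow> 0 < C t"
    and "\<And>t. 0 \<le> t \<Longrightarrow> log_sobolev (\<mu> t) (L t) (C t)"
    and "1 < p" "p \<le> q"
    and "0 \<le> s" "s \<le> t"
    and "(\<integral>\<^sup>+r\<in>{s..t}. ennreal (lam r / C r) \<partial>lebesgue) \<ge> ennreal (1 / 4 * ln ((q - 1) / (p - 1)))"
  shows "Lp_norm (\<mu> s) q (backward_prop lam L (neg_dlog \<mu>) s t f)
           \<le> exp (integral {s..t} (\<lambda>r. MAX x. max (- neg_dlog \<mu> r x) 0)) * Lp_norm (\<mu> t) p f"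
proof -
  define H where "H = neg_dlog \<mu>"
  define M where "M r = (MAX x. max (- H r x) 0)" for r
  have Hc: "continuous_on {0..} (\<lambda>r. H r x)" for x
    unfolding H_def by (rule neg_dlog_properties(1)[OF assms(1-3)])
  have dm: "((\<lambda>r. pmf (\<mu> r) x) has_real_derivative - H r x * pmf (\<mu> r) x) (at r within {0..})"
    if "0 \<le> r" for r x
    unfolding H_def by (rule neg_dlog_properties(2)[OF assms(1-3) that])
  have Mc: "continuous_on {0..} M"
    unfolding M_def by (intro continuous_on_MAX continuous_intros Hc)
  have M: "0 \<le> M r" "- H r x \<le> M r" for r x
  proof -
    have "max (- H r x) 0 \<le> M r" for x
      unfolding M_def by (intro Max_ge) auto
    from order_trans[OF max.cobounded2 this] order_trans[OF max.cobounded1 this]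
    show "0 \<le> M r" "- H r x \<le> M r" .
  qed
  have sub: "{s..t} \<subseteq> {0..}" "{0..t} \<subseteq> {0..}" "{s..t} \<subseteq> {0..t}" "0 \<le> t" "s \<in> {0..t}"
    using \<open>0 \<le> s\<close> \<open>s \<le> t\<close> by auto
  have conts: "continuous_on {0..t} (\<lambda>r. L r x y)" "continuous_on {0..t} lam"
    "continuous_on {0..t} (\<lambda>r. H r x)" for x y
    using continuous_on_subset[OF _ sub(2)] assms(5,7) Hc by blast+
  have contss: "continuous_on {s..t} (\<lambda>r. L r x y)" "continuous_on {s..t} lam"
    "continuous_on {s..t} (\<lambda>r. H r x)" for x y
    using continuous_on_subset[OF _ sub(1)] assms(5,7) Hc by blast+
  have "ln ((q - 1) / (p - 1)) \<ge> 0" using \<open>1 < p\<close> \<open>p \<le> q\<close> by (intro ln_ge_zero) (simp add: field_simps)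
  moreover have "(\<lambda>r. lam r / C r) \<in> borel_measurable (lebesgue_on {s..t})"
  proof -
    have [measurable]: "C \<in> borel_measurable (lebesgue_on {s..t})"
      using measurable_restrict_mono[OF assms(9) sub(1)] .
    have [measurable]: "lam \<in> borel_measurable (lebesgue_on {s..t})"
      by (rule continuous_imp_measurable_on_sets_lebesgue[OF contss(2)]) simp
    show ?thesis by measurable
  qed
  ultimately obtain a where a: "a integrable_on {s..t}" "\<And>r. r \<in> {s..t} \<Longrightarrow> 0 \<le> a r \<and> a r \<le> lam r / C r"
    "integral {s..t} a = 1 / 4 * ln ((q - 1) / (p - 1))"
    using assms(8,10,16) sub
    by (elim integrable_minorant_with_integral[of "\<lambda>r. lam r / C r" s t "1 / 4 * ln ((q - 1) / (p - 1))", rotated -1])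
       (auto simp: less_imp_le)
  have positive: "Lp_norm (\<mu> s) q (u s) \<le> exp (integral {s..t} M) * Lp_norm (\<mu> t) p g"
    if u: "solves_backward lam L H t g u" "\<And>r x. r \<in> {0..t} \<Longrightarrow> 0 < u r x" for u g
  proof -
    have ut: "u t = g" using u(1) by (simp add: solves_backward_def)
    have "Lp_norm (\<mu> s) q (u s) \<le> exp (integral {s..t} M) * Lp_norm (\<mu> t) p (u t)"
    proof (rule hypercontractive_positive[where \<mu> = \<mu> and H = H and L = L and lam = lam and C = C and a = a])
      fix r x assume r: "r \<in> {s..t}"
      then have r0: "0 \<le> r" "r \<in> {0..t}" using sub by auto
      show "((\<lambda>r. u r x) has_real_derivative - (lam r * gen (L r) (u r) x - H r x * u r x)) (at r within {s..t})"
        using u(1) r0 sub(3) unfolding solves_backward_def by (blast intro: DERIV_subset)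
      show "((\<lambda>r. pmf (\<mu> r) x) has_real_derivative - H r x * pmf (\<mu> r) x) (at r within {s..t})"
        using dm[OF r0(1)] sub(1) by (blast intro: DERIV_subset)
      show "0 < u r x" by (rule u(2)[OF r0(2)])
      show "0 < pmf (\<mu> r) x" "q_matrix (L r)" "detailed_balance (\<mu> r) (L r)"
        "log_sobolev (\<mu> r) (L r) (C r)" "0 < C r"
        using assms(1,4,6,10,11) r0(1) by blast+
      show "0 \<le> lam r" using assms(8)[OF r0(1)] by simp
      show "0 \<le> a r \<and> a r \<le> lam r / C r" by (rule a(2)[OF r])
    next
      show "M integrable_on {s..t}"
        by (intro integrable_continuous_real continuous_on_subset[OF Mc] sub)
    qed (use contss M a(1,3) assms(12,13,15) in simp_all)
    then show ?thesis by (simp add: ut)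
  qed
  have ex: "\<exists>u. solves_backward lam L H t g u \<and>
      ((\<forall>x. 0 \<le> g x) \<longrightarrow> (\<forall>s\<in>{0..t}. \<forall>x. 0 \<le> u s x)) \<and>
      ((\<forall>x. 0 < g x) \<longrightarrow> (\<forall>s\<in>{0..t}. \<forall>x. 0 < u s x))" for g
    by (rule solves_backward_exists) (use \<open>0 \<le> t\<close> conts assms(4,8) in \<open>simp_all add: less_imp_le\<close>)
  have prop_eq: "backward_prop lam L H s t g = u s" if "solves_backward lam L H t g u" for g u
    by (rule backward_prop_eq) (use conts that sub(5) in simp_all)
  obtain u where u: "solves_backward lam L H t f u"
    using ex by blast
  have bound: "Lp_norm (\<mu> s) q (u s) \<le> exp (integral {s..t} M) * Lp_norm (\<mu> t) p (\<lambda>x. \<bar>f x\<bar> + \<epsilon>)"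
    if "\<epsilon> > 0" for \<epsilon>
  proof -
    \<comment> \<open>The shift by \<open>\<epsilon>\<close> makes the terminal function strictly
      positive, so that \<open>w\<close> is positive and the estimate \<open>positive\<close>, which
      takes logarithms and real powers, applies.\<close>
    have "0 < \<bar>f x\<bar> + \<epsilon>" for x using that by linarith
    then obtain w where w: "solves_backward lam L H t (\<lambda>x. \<bar>f x\<bar> + \<epsilon>) w" "\<And>r x. r \<in> {0..t} \<Longrightarrow> 0 < w r x"
      using ex[of "\<lambda>x. \<bar>f x\<bar> + \<epsilon>"] by blast
    \<comment> \<open>Positivity preservation applied to
      \<open>\<bar>f\<bar> + \<epsilon> - c * f\<close> with \<open>c = 1\<close> and
      \<open>c = -1\<close>. By uniqueness its nonnegative solution agrees at time \<open>s\<close>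
      with \<open>w - c * u\<close>, which yields
      \<open>\<bar>u s x\<bar> \<le> w s x\<close>.\<close>
    have le: "c * u s x \<le> w s x" if c: "\<bar>c\<bar> = 1" for c x
    proof -
      have "0 \<le> \<bar>f x\<bar> + \<epsilon> - c * f x" for x
        using c \<open>\<epsilon> > 0\<close> abs_ge_self[of "c * f x"] by (simp add: abs_mult)
      then obtain z where z: "solves_backward lam L H t (\<lambda>x. \<bar>f x\<bar> + \<epsilon> - c * f x) z" "0 \<le> z s x"
        using ex[of "\<lambda>x. \<bar>f x\<bar> + \<epsilon> - c * f x"] sub(5) by blast
      have lc: "solves_backward lam L H t (\<lambda>x. \<bar>f x\<bar> + \<epsilon> - c * f x) (\<lambda>r x. w r x - c * u r x)"
        using solves_backward_lincomb[OF w(1) u, of 1 "- c"] by simp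
      have "z s = (\<lambda>x. w s x - c * u s x)"
        using prop_eq[OF z(1)] prop_eq[OF lc] by simp
      with z(2) show ?thesis by simp
    qed
    have "\<bar>u s x\<bar> \<le> \<bar>w s x\<bar>" for x
      using le[of 1 x] le[of "-1" x] by simp
    then have "Lp_norm (\<mu> s) q (u s) \<le> Lp_norm (\<mu> s) q (w s)"
      using \<open>1 < p\<close> \<open>p \<le> q\<close> by (intro Lp_norm_mono) auto
    also have "\<dots> \<le> exp (integral {s..t} M) * Lp_norm (\<mu> t) p (\<lambda>x. \<bar>f x\<bar> + \<epsilon>)"
      by (rule positive[OF w])
    finally show ?thesis .
  qed
  \<comment> \<open>The left side does not depend on \<open>\<epsilon>\<close>, so the bound
    survives the limit of \<open>\<epsilon>\<close> to 0 from the right.\<close>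
  have "Lp_norm (\<mu> s) q (u s) \<le> exp (integral {s..t} M) * Lp_norm (\<mu> t) p (\<lambda>x. \<bar>f x\<bar>)"
  proof (rule tendsto_lowerbound)
    show "((\<lambda>\<epsilon>. exp (integral {s..t} M) * Lp_norm (\<mu> t) p (\<lambda>x. \<bar>f x\<bar> + \<epsilon>)) \<longlongrightarrow>
        exp (integral {s..t} M) * Lp_norm (\<mu> t) p (\<lambda>x. \<bar>f x\<bar>)) (at_right 0)"
      using \<open>1 < p\<close> by (intro tendsto_intros Lp_norm_add_const_tendsto) auto
    show "\<forall>\<^sub>F \<epsilon> in at_right 0. Lp_norm (\<mu> s) q (u s)
        \<le> exp (integral {s..t} M) * Lp_norm (\<mu> t) p (\<lambda>x. \<bar>f x\<bar> + \<epsilon>)"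
      by (rule eventually_at_rightI[of 0 1]) (auto intro: bound)
  qed simp
  moreover have "Lp_norm (\<mu> t) p (\<lambda>x. \<bar>f x\<bar>) = Lp_norm (\<mu> t) p f" by (simp add: Lp_norm_def)
  moreover have "backward_prop lam L H s t f = u s"
    by (rule prop_eq[OF u])
  moreover have "M = (\<lambda>r. MAX x. max (- neg_dlog \<mu> r x) 0)"
    by (simp add: M_def H_def fun_eq_iff)
  ultimately show ?thesis by (simp only: H_def)
qed

end
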